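(* Let $\mathcal{S}$ be the set of permutations that avoid the four patterns $2\underline{41}3$, $3\underline{14}2$, $41323^+$ and $42313^+$. Let the permutations of $\mathcal{S}$ grow by insertion of a new maximal element. That is, the children of $\sigma\in\mathcal{S}$ of size $n$ are the permutations of $\mathcal{S}$ of size $n+1$ obtained by inserting the value $n+1$ somewhere in $\sigma$. Then the resulting generating tree, rooted at the permutation $1$, is isomorphic to the generating tree $\mathcal{T}_{\mathrm{Sch}}$ of the succession rule with root $(1,1)$ and productions $$(h,k)\rightsquigarrow(1,k+1),\ldots,(h,k+1),(2,1),\ldots,(2,k-1),(h+1,k).$$ Consequently, $\mathcal{S}$ is enumerated by the large Schröder numbers $1,2,6,22,90,\ldots$, whose generating function is $\sum_{n\ge1}S_nx^{n-1}=(1-x-\sqrt{1-6x+x^2})/(2x)$.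
   Context: The pattern conditions on a permutation $\sigma=\sigma_1\cdots\sigma_n$ are as follows. - $\sigma$ avoids $2\underline{41}3$ if there are no indices $i<j<j+1<k$ with $\sigma_{j+1}<\sigma_i<\sigma_k<\sigma_j$. - $\sigma$ avoids $3\underline{14}2$ if there are no indices $i<j<j+1<k$ with $\sigma_j<\sigma_k<\sigma_i<\sigma_{j+1}$. - $\sigma$ avoids $41323^+$ (resp. $42313^+$) if there is no subsequence $\sigma_a\sigma_b\sigma_c\sigma_d\sigma_e$ (with $a<b<c<d<e$) satisfying all of the following: $\sigma_b<\sigma_d<\sigma_c$ (resp. $\sigma_d<\sigma_b<\sigma_c$), $\sigma_e=\sigma_c+1$, and $\sigma_e<\sigma_a$. A generating tree of a class is a rooted tree containing each object exactly once, with objects of size $n$ at depth $n$ (the root is at depth $1$). A succession rule determines a labelled tree in which each vertex with label $\lambda$ has one child per label in the production of $\lambda$. *)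

theory Defs
  imports Complex_Main "HOL-Combinatorics.Multiset_Permutations"
    "HOL-Computational_Algebra.Formal_Power_Series"
begin

text \<open>
  Permutations of size \<open>n\<close> are written in one-line notation, as lists in
  \<open>permutations_of_set {1..n}\<close>. Positions are counted from 0, values from 1.
\<close>

definition avoids_2_41_3 :: "nat list \<Rightarrow> bool" where
  "avoids_2_41_3 \<sigma> \<longleftrightarrow>
     \<not> (\<exists>i j k. i < j \<and> j + 1 < k \<and> k < length \<sigma> \<and>
          \<sigma> ! (j + 1) < \<sigma> ! i \<and> \<sigma> ! i < \<sigma> ! k \<and> \<sigma> ! k < \<sigma> ! j)"

definition avoids_3_14_2 :: "nat list \<Rightarrow> bool" where
  "avoids_3_14_2 \<sigma> \<longleftrightarrow>
     \<not> (\<exists>i j k. i < j \<and> j + 1 < k \<and> k < length \<sigma> \<and>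
          \<sigma> ! j < \<sigma> ! k \<and> \<sigma> ! k < \<sigma> ! i \<and> \<sigma> ! i < \<sigma> ! (j + 1))"

definition avoids_41323_plus :: "nat list \<Rightarrow> bool" where
  "avoids_41323_plus \<sigma> \<longleftrightarrow>
     \<not> (\<exists>a b c d e. a < b \<and> b < c \<and> c < d \<and> d < e \<and> e < length \<sigma> \<and>
          \<sigma> ! b < \<sigma> ! d \<and> \<sigma> ! d < \<sigma> ! c \<and> \<sigma> ! e = \<sigma> ! c + 1 \<and> \<sigma> ! e < \<sigma> ! a)"

definition avoids_42313_plus :: "nat list \<Rightarrow> bool" where
  "avoids_42313_plus \<sigma> \<longleftrightarrow>
     \<not> (\<exists>a b c d e. a < b \<and> b < c \<and> c < d \<and> d < e \<and> e < length \<sigma> \<and>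
          \<sigma> ! d < \<sigma> ! b \<and> \<sigma> ! b < \<sigma> ! c \<and> \<sigma> ! e = \<sigma> ! c + 1 \<and> \<sigma> ! e < \<sigma> ! a)"

text \<open>The empty permutation is excluded: sizes start at 1.\<close>

definition S_class :: "nat list set" where
  "S_class = {\<sigma>. (\<exists>n\<ge>1. \<sigma> \<in> permutations_of_set {1..n}) \<and>
     avoids_2_41_3 \<sigma> \<and> avoids_3_14_2 \<sigma> \<and> avoids_41323_plus \<sigma> \<and> avoids_42313_plus \<sigma>}"


record 'v rtree =
  tverts :: "'v set"
  troot :: 'v
  tedges :: "('v \<times> 'v) set"  \<comment> \<open>pairs (parent, child)\<close>

definition is_rooted_tree :: "'v rtree \<Rightarrow> bool" where
  "is_rooted_tree T \<longleftrightarrow>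
     troot T \<in> tverts T \<and>
     tedges T \<subseteq> tverts T \<times> tverts T \<and>
     (\<nexists>u. (u, troot T) \<in> tedges T) \<and>
     (\<forall>v\<in>tverts T - {troot T}. \<exists>!u. (u, v) \<in> tedges T) \<and>
     (\<forall>v\<in>tverts T. (troot T, v) \<in> (tedges T)\<^sup>*)"

text \<open>The root has depth 1.\<close>

inductive has_depth :: "'v rtree \<Rightarrow> 'v \<Rightarrow> nat \<Rightarrow> bool" for T where
  "has_depth T (troot T) 1"
| "has_depth T u d \<Longrightarrow> (u, v) \<in> tedges T \<Longrightarrow> has_depth T v (Suc d)"

definition is_generating_tree :: "'v set \<Rightarrow> ('v \<Rightarrow> nat) \<Rightarrow> 'v rtree \<Rightarrow> bool" where
  "is_generating_tree C sz T \<longleftrightarrow>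
     is_rooted_tree T \<and> tverts T = C \<and> (\<forall>v\<in>C. has_depth T v (sz v))"

text \<open>Isomorphism of rooted trees; the children of a vertex are unordered.\<close>

definition rtree_iso :: "'v rtree \<Rightarrow> 'w rtree \<Rightarrow> bool" where
  "rtree_iso T U \<longleftrightarrow>
     (\<exists>f. bij_betw f (tverts T) (tverts U) \<and> f (troot T) = troot U \<and>
       (\<forall>u\<in>tverts T. \<forall>v\<in>tverts T. (u, v) \<in> tedges T \<longleftrightarrow> (f u, f v) \<in> tedges U))"


definition max_insertion :: "nat list \<Rightarrow> nat list \<Rightarrow> bool" where
  "max_insertion \<sigma> \<tau> \<longleftrightarrow> (\<exists>xs ys. \<sigma> = xs @ ys \<and> \<tau> = xs @ [length \<sigma> + 1] @ ys)"

definition S_tree :: "nat list rtree" where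
  "S_tree = \<lparr>tverts = S_class, troot = [1],
     tedges = {(\<sigma>, \<tau>). \<sigma> \<in> S_class \<and> \<tau> \<in> S_class \<and> max_insertion \<sigma> \<tau>}\<rparr>"


text \<open>
  The tree of a succession rule with root label \<open>r\<close> and production \<open>P\<close> (a list of
  labels for each label, possibly with repetitions). A vertex is a pair of an address
  (the list of child indices on the path from the root) and its label; the address
  keeps vertices with the same label apart.
\<close>

inductive_set rule_verts :: "'l \<Rightarrow> ('l \<Rightarrow> 'l list) \<Rightarrow> (nat list \<times> 'l) set" for r P where
  "([], r) \<in> rule_verts r P"
| "(p, l) \<in> rule_verts r P \<Longrightarrow> i < length (P l) \<Longrightarrow> (p @ [i], P l ! i) \<in> rule_verts r P"

definition rule_tree :: "'l \<Rightarrow> ('l \<Rightarrow> 'l list) \<Rightarrow> (nat list \<times> 'l) rtree" where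
  "rule_tree r P = \<lparr>tverts = rule_verts r P, troot = ([], r),
     tedges = {((p, l), (p @ [i], P l ! i)) |p l i.
       (p, l) \<in> rule_verts r P \<and> i < length (P l)}\<rparr>"

fun sch_production :: "nat \<times> nat \<Rightarrow> (nat \<times> nat) list" where
  "sch_production (h, k) =
     map (\<lambda>i. (i, k + 1)) [1..<h+1] @ map (\<lambda>j. (2, j)) [1..<k] @ [(h + 1, k)]"

definition T_Sch :: "(nat list \<times> nat \<times> nat) rtree" where
  "T_Sch = rule_tree (1, 1) sch_production"


text \<open>The large Schroeder numbers, with the usual indexing from 0.\<close>

fun large_schroeder :: "nat \<Rightarrow> nat" where
  "large_schroeder 0 = 1"
| "large_schroeder (Suc n) =
     large_schroeder n + (\<Sum>i\<le>n. large_schroeder i * large_schroeder (n - i))"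

text \<open>
  Square root of a formal power series with positive constant coefficient: the one
  whose constant coefficient is the positive real root.
\<close>

abbreviation fps_sqrt :: "real fps \<Rightarrow> real fps" where
  "fps_sqrt F \<equiv> fps_radical root 2 F"

end

theory Submission
  imports Defs
begin

text \<open>
  In a permutation of the class with maximum \<open>n\<close>, a new maximum may be inserted exactly after
  each of the \<open>k\<close> right-to-left maxima, or before each of the \<open>h\<close> left-to-right maxima
  beyond which no \<open>b c d (c+1)\<close> with \<open>b, d < c\<close> occurs. Inserting on the left
  never creates such an obstruction. Inserting after a right-to-left maximum other than \<open>n\<close>
  creates the obstruction with \<open>c = n\<close>, which leaves only two left sites: just before
  \<open>n\<close> and just before the new maximum. Inserting just after \<open>n\<close> keeps all sites and
  adds one. Hence \<open>(h, k)\<close> obeys the succession rule.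

  For the enumeration, let \<open>S = 1 + x S + x S\<^sup>2\<close> be the large Schroeder series and
  \<open>u = (S + 1) / 2\<close>; the series of descendants of a vertex labelled \<open>(h, k)\<close>
  is \<open>S u^(h + k - 2)\<close>.
\<close>

section \<open>Trees of succession rules\<close>

lemma rule_verts_snocD:
  assumes "(p @ [i], l) \<in> rule_verts r P"
  shows "\<exists>l'. (p, l') \<in> rule_verts r P \<and> i < length (P l') \<and> l = P l' ! i"
  using assms by (cases rule: rule_verts.cases) auto

lemma rule_verts_NilD:
  assumes "([], l) \<in> rule_verts r P"
  shows "l = r"
  using assms by (cases rule: rule_verts.cases) auto

text \<open>Following an address of the rule tree through the child lists \<open>chl\<close> of
  \<open>T\<close> gives a map onto \<open>tverts T\<close>. It is injective because parents are
  unique and child lists have no repetitions, and its inverse is the isomorphism.\<close>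

lemma rtree_iso_rule_tree:
  fixes T :: "'v rtree" and chl :: "'v \<Rightarrow> 'v list" and lab :: "'v \<Rightarrow> 'l"
  assumes tree: "is_rooted_tree T"
    and root: "lab (troot T) = r"
    and dist: "\<And>v. v \<in> tverts T \<Longrightarrow> distinct (chl v)"
    and set_chl: "\<And>v. v \<in> tverts T \<Longrightarrow> set (chl v) = {w. (v, w) \<in> tedges T}"
    and lab_chl: "\<And>v. v \<in> tverts T \<Longrightarrow> map lab (chl v) = P (lab v)"
  shows "rtree_iso T (rule_tree r P)"
proof -
  define g where "g p = foldl (\<lambda>v i. chl v ! i) (troot T) p" for p
  have g_Nil [simp]: "g [] = troot T" and g_snoc [simp]: "g (p @ [i]) = chl (g p) ! i" for p i
    by (simp_all add: g_def)
  from tree have root_in: "troot T \<in> tverts T" and no_par: "\<And>u. (u, troot T) \<notin> tedges T"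
    and uniq: "\<And>u u' v. (u, v) \<in> tedges T \<Longrightarrow> (u', v) \<in> tedges T \<Longrightarrow> u = u'"
    and reach: "\<And>v. v \<in> tverts T \<Longrightarrow> (troot T, v) \<in> (tedges T)\<^sup>*"
    and sub: "tedges T \<subseteq> tverts T \<times> tverts T"
    unfolding is_rooted_tree_def by blast+
  have len: "length (P (lab v)) = length (chl v)" if "v \<in> tverts T" for v
    using lab_chl[OF that] by (metis length_map)
  have edge: "(v, chl v ! i) \<in> tedges T \<and> lab (chl v ! i) = P (lab v) ! i"
    if "v \<in> tverts T" "i < length (chl v)" for v i
    using set_chl[OF that(1)] lab_chl[OF that(1)] that(2) nth_mem[OF that(2)]
    by (metis mem_Collect_eq nth_map)
  have g_in: "g p \<in> tverts T \<and> lab (g p) = l" if "(p, l) \<in> rule_verts r P" for p l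
    using that
  proof (induction rule: rule_verts.induct)
    case 1
    show ?case using root_in root by simp
  next
    case (2 p l i)
    then show ?case using edge[of "g p" i] len[of "g p"] sub by auto
  qed
  have g_edge: "(g p, g (p @ [i])) \<in> tedges T"
    if "(p, l) \<in> rule_verts r P" "i < length (P l)" for p l i
    using g_in[OF that(1)] edge[of "g p" i] len[of "g p"] that(2) by auto
  have g_surj: "\<exists>p. (p, lab v) \<in> rule_verts r P \<and> g p = v" if "v \<in> tverts T" for v
    using reach[OF that]
  proof (induction rule: rtrancl_induct)
    case base
    show ?case using rule_verts.intros(1)[of r P] root by (intro exI[of _ "[]"]) simp
  next
    case (step u v)
    then obtain p where p: "(p, lab u) \<in> rule_verts r P" "g p = u" by blast
    from step(2) sub have u: "u \<in> tverts T" by auto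
    with step(2) set_chl[OF u] obtain i where i: "i < length (chl u)" "v = chl u ! i"
      by (metis in_set_conv_nth mem_Collect_eq)
    show ?case
      using rule_verts.intros(2)[OF p(1), of i] i len[OF u] p(2) edge[OF u i(1)]
      by (intro exI[of _ "p @ [i]"]) simp
  qed
  have g_inj: "p = p' \<and> l = l'"
    if "(p, l) \<in> rule_verts r P" "(p', l') \<in> rule_verts r P" "g p = g p'" for p l p' l'
    using that
  \<comment> \<open>Addresses are compared from their last index backwards. The unique parent
    identifies the prefixes, distinctness of the child list identifies the last indices, and the
    root has no parent.\<close>
  proof (induction p arbitrary: p' l l' rule: rev_induct)
    case Nil
    have "p' = []"
    proof (cases p' rule: rev_cases)
      case (snoc q i)
      with Nil(2) obtain l0 where "(q, l0) \<in> rule_verts r P" "i < length (P l0)"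
        using rule_verts_snocD by metis
      from g_edge[OF this] Nil(3) snoc no_par show ?thesis by simp
    qed
    with Nil show ?case using rule_verts_NilD by metis
  next
    case (snoc i p)
    from snoc(2) obtain l0 where l0: "(p, l0) \<in> rule_verts r P" "i < length (P l0)" "l = P l0 ! i"
      using rule_verts_snocD by metis
    note e = g_edge[OF l0(1,2)]
    show ?case
    proof (cases p' rule: rev_cases)
      case Nil
      then show ?thesis using e snoc(4) no_par by simp
    next
      case p': (snoc q j)
      with snoc(3) obtain l1 where l1: "(q, l1) \<in> rule_verts r P" "j < length (P l1)" "l' = P l1 ! j"
        using rule_verts_snocD by metis
      have "g p = g q" using uniq[OF e] g_edge[OF l1(1,2)] snoc(4) p' by metis
      with snoc(1)[OF l0(1) l1(1)] have eq: "p = q" "l0 = l1" by auto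
      have "i = j"
        using snoc(4) dist[of "g p"] g_in[OF l0(1)] len[of "g p"] l0(2) l1(2) p' eq
        by (auto simp: nth_eq_iff_index_eq)
      with eq p' l0 l1 show ?thesis by simp
    qed
  qed
  define G where "G = (\<lambda>(p, l :: 'l). g p)"
  have bij: "bij_betw G (rule_verts r P) (tverts T)"
    unfolding bij_betw_def
  proof (intro conjI equalityI subsetI)
    show "inj_on G (rule_verts r P)"
      unfolding G_def inj_on_def using g_inj by fast
    show "x \<in> tverts T" if "x \<in> G ` rule_verts r P" for x
      using that g_in by (auto simp: G_def)
    show "x \<in> G ` rule_verts r P" if "x \<in> tverts T" for x
      using g_surj[OF that] by (force simp: G_def)
  qed
  have edges: "(G x, G y) \<in> tedges T \<longleftrightarrow> (x, y) \<in> tedges (rule_tree r P)"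
    if x: "x \<in> rule_verts r P" and y: "y \<in> rule_verts r P" for x y
  proof
    assume "(x, y) \<in> tedges (rule_tree r P)"
    then show "(G x, G y) \<in> tedges T"
      using g_edge by (auto simp: rule_tree_def G_def simp del: g_snoc)
  next
    assume e: "(G x, G y) \<in> tedges T"
    obtain p l where xp: "x = (p, l)" by fastforce
    have v: "g p \<in> tverts T" "lab (g p) = l" using g_in x xp by auto
    from e set_chl[OF v(1)] obtain i where i: "i < length (chl (g p))" "G y = chl (g p) ! i"
      by (metis (mono_tags, lifting) G_def case_prod_conv in_set_conv_nth mem_Collect_eq xp)
    have il: "i < length (P l)" using i len[OF v(1)] v by simp
    \<comment> \<open>The extended address is a vertex with the same image as \<open>y\<close>, so
      injectivity of \<open>G\<close> makes it equal to \<open>y\<close>.\<close>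
    have "(p @ [i], P l ! i) \<in> rule_verts r P"
      using rule_verts.intros(2) x xp il by metis
    moreover have "G (p @ [i], P l ! i) = G y" using i by (simp add: G_def)
    ultimately have "y = (p @ [i], P l ! i)"
      using bij y by (metis bij_betw_def inj_onD)
    then show "(x, y) \<in> tedges (rule_tree r P)"
      using x xp il by (auto simp: rule_tree_def)
  qed
  define f where "f = inv_into (rule_verts r P) G"
  have f: "bij_betw f (tverts T) (rule_verts r P)"
    unfolding f_def by (rule bij_betw_inv_into[OF bij])
  have Gf: "G (f v) = v" if "v \<in> tverts T" for v
    unfolding f_def using bij that by (metis bij_betw_inv_into_right)
  have fin: "f v \<in> rule_verts r P" if "v \<in> tverts T" for v
    using f that by (metis bij_betwE)
  have "f (troot T) = ([], r)"
  proof -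
    have "G ([], r) = troot T" by (simp add: G_def)
    then show ?thesis
      unfolding f_def using bij rule_verts.intros(1) by (metis bij_betw_inv_into_left)
  qed
  moreover have "(u, v) \<in> tedges T \<longleftrightarrow> (f u, f v) \<in> tedges (rule_tree r P)"
    if "u \<in> tverts T" "v \<in> tverts T" for u v
    using edges[OF fin fin] Gf that by metis
  ultimately show ?thesis
    unfolding rtree_iso_def
    by (intro exI[of _ f]) (use f in \<open>simp add: rule_tree_def\<close>)
qed

section \<open>Counting the vertices of the Schroeder rule\<close>

unbundle fps_syntax

section \<open>The large Schroeder series and its closed form\<close>

definition schroeder_fps :: "real fps" where
  "schroeder_fps = Abs_fps (\<lambda>m. real (large_schroeder m))"

lemma schroeder_fps_eq:
  "schroeder_fps = 1 + fps_X * schroeder_fps + fps_X * schroeder_fps ^ 2"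
proof -
  have "schroeder_fps = 1 + fps_X * (schroeder_fps + schroeder_fps * schroeder_fps)"
  proof (rule fps_ext)
    fix n
    have "(schroeder_fps * schroeder_fps) $ m =
        (\<Sum>i\<le>m. real (large_schroeder i) * real (large_schroeder (m - i)))" for m
      by (simp add: schroeder_fps_def fps_mult_nth atLeast0AtMost)
    then show "schroeder_fps $ n =
        (1 + fps_X * (schroeder_fps + schroeder_fps * schroeder_fps)) $ n"
      by (cases n) (simp_all add: schroeder_fps_def)
  qed
  then show ?thesis by (simp add: algebra_simps power2_eq_square)
qed

text \<open>The functional equation is quadratic in the series; completing the square gives the
  radicand. The sign is settled by the constant coefficient, which is 1 for
  \<open>1 - fps_X - 2 * fps_X * schroeder_fps\<close>.\<close>

lemma schroeder_fps_closed_form: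
  "schroeder_fps = (1 - fps_X - fps_sqrt (1 - 6 * fps_X + fps_X ^ 2)) / (2 * fps_X)"
proof -
  let ?S = schroeder_fps
  have sq: "(1 - fps_X - 2 * fps_X * ?S) ^ 2 = 1 - 6 * fps_X + fps_X ^ 2"
    using schroeder_fps_eq by algebra
  have "fps_sqrt (1 - 6 * fps_X + fps_X ^ 2) = 1 - fps_X - 2 * fps_X * ?S"
  proof -
    \<comment> \<open>The exponent is put in the successor form in which
      \<open>radical_unique\<close> expects it.\<close>
    have "(1 - fps_X - 2 * fps_X * ?S) ^ Suc 1 = 1 - 6 * fps_X + fps_X ^ 2"
      using sq by (simp add: numeral_2_eq_2)
    then show ?thesis
      using radical_unique[of root 1 "1 - 6 * fps_X + fps_X ^ 2" "1 - fps_X - 2 * fps_X * ?S"]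
      by (simp add: numeral_2_eq_2)
  qed
  then have "1 - fps_X - fps_sqrt (1 - 6 * fps_X + fps_X ^ 2) = ?S * (2 * fps_X)"
    by simp
  moreover have "(2 * fps_X :: real fps) \<noteq> 0" by simp
  ultimately show ?thesis
    by (metis nonzero_mult_div_cancel_right)
qed

section \<open>Counting descendants under the succession rule\<close>

fun sch_descendants :: "nat \<Rightarrow> nat \<times> nat \<Rightarrow> nat" where
  "sch_descendants 0 l = 1"
| "sch_descendants (Suc n) l = (\<Sum>l'\<leftarrow>sch_production l. sch_descendants n l')"

text \<open>The series of descendants depends on \<open>(h, k)\<close> only through \<open>m = h + k\<close>, on which
  the rule acts as \<open>m \<leadsto> 3, \<dots>, m, m + 1, m + 1\<close>; \<open>desc_fps\<close> is indexed by \<open>m - 2\<close>.\<close>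

definition desc_fps :: "nat \<Rightarrow> real fps" where
  "desc_fps m = schroeder_fps * ((schroeder_fps + 1) * fps_const (1/2)) ^ m"

text \<open>For \<open>algebra\<close> the constant \<open>fps_const (1/2)\<close> is an unknown;
  this equation supplies its value.\<close>

lemma fps_half: "2 * fps_const (1/2) = (1 :: real fps)"
  by (simp only: numeral_fps_const fps_const_mult) simp

text \<open>The base case is the functional equation of the Schroeder series. Two consecutive
  instances differ by a multiple of one quadratic equation for the ratio \<open>u\<close> of the
  geometric sequence \<open>desc_fps\<close>.\<close>

lemma desc_fps_eq:
  "desc_fps m = 1 + fps_X * ((\<Sum>j\<in>{1..<m + 2}. desc_fps j) + desc_fps (m + 1))"
proof (induction m)
  case 0
  have "desc_fps 0 = 1 + fps_X * (desc_fps 1 + desc_fps 1)"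
    unfolding desc_fps_def power_0 power_one_right mult_1_right
    using schroeder_fps_eq fps_half by algebra
  then show ?case by (simp add: numeral_2_eq_2)
next
  case (Suc m)
  define u where "u = (schroeder_fps + 1) * fps_const (1/2)"
  have D: "desc_fps i = schroeder_fps * u ^ i" for i
    by (simp add: desc_fps_def u_def)
  \<comment> \<open>This is the functional equation after the substitution S = 2u - 1.\<close>
  have u: "u - 1 = fps_X * (2 * u\<^sup>2 - u)"
    unfolding u_def using schroeder_fps_eq fps_half by algebra
  have "desc_fps (m + 1) - desc_fps m = desc_fps m * (u - 1)"
    by (simp add: D algebra_simps)
  also have "\<dots> = fps_X * (2 * desc_fps (m + 2) - desc_fps (m + 1))"
    unfolding u by (simp add: D algebra_simps power2_eq_square)
  finally have "desc_fps (m + 1) - desc_fps m =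
      fps_X * (2 * desc_fps (m + 2) - desc_fps (m + 1))" .
  \<comment> \<open>From \<open>m\<close> to \<open>m + 1\<close> the sum gains
    \<open>desc_fps (m + 2)\<close>, and the extra term changes from index \<open>m + 1\<close> to
    \<open>m + 2\<close>. This is exactly the difference just computed.\<close>
  moreover have "(\<Sum>j\<in>{1..<Suc m + 2}. desc_fps j) = (\<Sum>j\<in>{1..<m + 2}. desc_fps j) + desc_fps (m + 2)"
    by simp
  ultimately show ?case
    using Suc unfolding add_Suc by (simp only: Suc_eq_plus1 add.assoc one_add_one) algebra
qed

lemma desc_fps_Suc_nth:
  "desc_fps m $ Suc n = (\<Sum>j\<in>{1..<m + 2}. desc_fps j $ n) + desc_fps (m + 1) $ n"
proof -
  have "desc_fps m $ Suc n = (fps_X * ((\<Sum>j\<in>{1..<m + 2}. desc_fps j) + desc_fps (m + 1))) $ Suc n"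
    by (subst desc_fps_eq) simp
  also have "\<dots> = ((\<Sum>j\<in>{1..<m + 2}. desc_fps j) + desc_fps (m + 1)) $ n"
    unfolding fps_X_mult_nth by simp
  finally show ?thesis by (simp only: fps_add_nth fps_sum_nth)
qed

lemma sch_descendants_eq:
  assumes "h \<ge> 1" "k \<ge> 1"
  shows "real (sch_descendants n (h, k)) = desc_fps (h + k - 2) $ n"
  using assms
proof (induction n arbitrary: h k)
  case 0
  have "schroeder_fps $ 0 = 1" by (simp add: schroeder_fps_def)
  then show ?case by (simp add: desc_fps_def fps_power_zeroth)
next
  case (Suc n)
  have "real (sch_descendants (Suc n) (h, k)) =
      (\<Sum>i\<leftarrow>[1..<h + 1]. real (sch_descendants n (i, k + 1))) +
      (\<Sum>j\<leftarrow>[1..<k]. real (sch_descendants n (2, j))) + real (sch_descendants n (h + 1, k))"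
    by (simp add: comp_def flip: sum_list_of_nat del: upt_Suc)
  \<comment> \<open>The three families of labels have indices \<open>i + k - 1\<close>,
    \<open>j\<close> and \<open>h + k - 1\<close>. The first covers \<open>k\<close> to
    \<open>h + k - 1\<close> and the second 1 to \<open>k - 1\<close>, so together they fill an
    interval; the last repeats its top.\<close>
  also have "\<dots> = (\<Sum>i\<in>{1..<h + 1}. desc_fps (i + k - 1) $ n) +
      (\<Sum>j\<in>{1..<k}. desc_fps j $ n) + desc_fps (h + k - 1) $ n"
    using Suc by (simp add: interv_sum_list_conv_sum_set_nat del: upt_Suc)
  also have "(\<Sum>i\<in>{1..<h + 1}. desc_fps (i + k - 1) $ n) = (\<Sum>j\<in>{k..<h + k}. desc_fps j $ n)"
    using Suc.prems
    by (intro sum.reindex_bij_witness[of _ "\<lambda>j. j + 1 - k" "\<lambda>i. i + k - 1"]) auto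
  also have "\<dots> + (\<Sum>j\<in>{1..<k}. desc_fps j $ n) = (\<Sum>j\<in>{1..<h + k}. desc_fps j $ n)"
    using Suc.prems sum.atLeastLessThan_concat[of 1 k "h + k" "\<lambda>j. desc_fps j $ n"] by simp
  also have "\<dots> + desc_fps (h + k - 1) $ n = desc_fps (h + k - 2) $ Suc n"
    using Suc.prems by (simp add: desc_fps_Suc_nth Suc_diff_Suc numeral_2_eq_2)
  finally show ?case .
qed

lemma sch_descendants_root: "sch_descendants n (1, 1) = large_schroeder n"
proof -
  have "real (sch_descendants n (1, 1)) = real (large_schroeder n)"
    by (subst sch_descendants_eq) (simp_all add: desc_fps_def schroeder_fps_def)
  then show ?thesis by simp
qed

section \<open>Insertion of a new maximum\<close>

text \<open>\<open>p\<close> is the position of the new maximum in the result: inserting just before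
  the entry at \<open>x\<close> is \<open>p = x\<close>, just after it
  \<open>p = Suc x\<close>.\<close>

definition ins :: "nat \<Rightarrow> nat list \<Rightarrow> nat list" where
  "ins p \<sigma> = take p \<sigma> @ [Suc (length \<sigma>)] @ drop p \<sigma>"

text \<open>The size is read off the length, so that no separate parameter has to be carried
  along.\<close>

definition is_perm :: "nat list \<Rightarrow> bool" where
  "is_perm \<sigma> \<longleftrightarrow> distinct \<sigma> \<and> set \<sigma> = {1..length \<sigma>}"

lemma length_ins [simp]: "p \<le> length \<sigma> \<Longrightarrow> length (ins p \<sigma>) = Suc (length \<sigma>)"
  by (simp add: ins_def)

lemma ins_nth:
  "p \<le> length \<sigma> \<Longrightarrow> ins p \<sigma> ! x =
    (if x < p then \<sigma> ! x else if x = p then Suc (length \<sigma>) else \<sigma> ! (x - 1))"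
  by (auto simp: ins_def nth_append nth_Cons' min_def)

lemma is_perm_permutations_of_set:
  "is_perm \<sigma> \<longleftrightarrow> \<sigma> \<in> permutations_of_set {1..length \<sigma>}"
  by (auto simp: is_perm_def permutations_of_set_def)

lemma is_perm_nth_le: "is_perm \<sigma> \<Longrightarrow> x < length \<sigma> \<Longrightarrow> \<sigma> ! x \<le> length \<sigma>"
  by (metis is_perm_def atLeastAtMost_iff nth_mem)

lemma is_perm_nth_inj:
  "is_perm \<sigma> \<Longrightarrow> x < length \<sigma> \<Longrightarrow> y < length \<sigma> \<Longrightarrow> \<sigma> ! x = \<sigma> ! y \<Longrightarrow> x = y"
  by (metis is_perm_def nth_eq_iff_index_eq)

lemma is_perm_ins:
  assumes "p \<le> length \<sigma>"
  shows "is_perm (ins p \<sigma>) \<longleftrightarrow> is_perm \<sigma>"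
proof -
  have "set (take p \<sigma>) \<union> set (drop p \<sigma>) = set \<sigma>"
    by (metis append_take_drop_id set_append)
  then have set_eq: "set (ins p \<sigma>) = insert (Suc (length \<sigma>)) (set \<sigma>)"
    by (auto simp: ins_def)
  have "distinct (ins p \<sigma>) \<longleftrightarrow> Suc (length \<sigma>) \<notin> set \<sigma> \<and> distinct (take p \<sigma> @ drop p \<sigma>)"
    by (auto simp: ins_def simp del: append_take_drop_id dest: in_set_takeD in_set_dropD)
      (metis UnE append_take_drop_id set_append)
  then have dist_eq: "distinct (ins p \<sigma>) \<longleftrightarrow> Suc (length \<sigma>) \<notin> set \<sigma> \<and> distinct \<sigma>"
    by simp
  have "{1..Suc (length \<sigma>)} = insert (Suc (length \<sigma>)) {1..length \<sigma>}" by auto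
  then show ?thesis
    unfolding is_perm_def length_ins[OF assms] set_eq dist_eq
    by (metis Suc_n_not_le_n atLeastAtMost_iff insert_ident)
qed

lemma remove1_ins:
  assumes "is_perm \<sigma>" "p \<le> length \<sigma>"
  shows "remove1 (Suc (length \<sigma>)) (ins p \<sigma>) = \<sigma>"
proof -
  have "Suc (length \<sigma>) \<notin> set (take p \<sigma>)"
    using assms by (auto simp: is_perm_def dest: in_set_takeD)
  then show ?thesis by (simp add: ins_def remove1_append)
qed

text \<open>The maximum occurs once, and its position is the insertion point.\<close>

lemma ins_inj:
  assumes "is_perm \<sigma>" "p \<le> length \<sigma>" "p' \<le> length \<sigma>" "ins p \<sigma> = ins p' \<sigma>"
  shows "p = p'"
  using is_perm_nth_inj[of "ins p \<sigma>" p p'] assms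
  by (simp add: is_perm_ins) (metis assms(4) ins_nth less_Suc_eq_le less_irrefl)

lemma is_perm_ex_ins:
  assumes "is_perm \<tau>" "length \<tau> = Suc n"
  obtains \<sigma> p where "is_perm \<sigma>" "length \<sigma> = n" "p \<le> n" "\<tau> = ins p \<sigma>"
proof -
  from assms have "Suc n \<in> set \<tau>" by (simp add: is_perm_def)
  then obtain xs ys where \<tau>: "\<tau> = xs @ Suc n # ys" by (auto simp: in_set_conv_decomp)
  let ?\<sigma> = "xs @ ys" let ?p = "length xs"
  have "length ?\<sigma> = n" "\<tau> = ins ?p ?\<sigma>" "?p \<le> n" using assms(2) \<tau> by (auto simp: ins_def)
  moreover from this have "is_perm ?\<sigma>" using assms(1) is_perm_ins[of ?p ?\<sigma>] by simp
  ultimately show ?thesis using that by blast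
qed

lemma max_insertion_iff_ins: "max_insertion \<sigma> \<tau> \<longleftrightarrow> (\<exists>p\<le>length \<sigma>. \<tau> = ins p \<sigma>)"
proof
  assume "max_insertion \<sigma> \<tau>"
  then obtain xs ys where "\<sigma> = xs @ ys" "\<tau> = xs @ [length \<sigma> + 1] @ ys"
    unfolding max_insertion_def by blast
  then show "\<exists>p\<le>length \<sigma>. \<tau> = ins p \<sigma>"
    by (intro exI[of _ "length xs"]) (simp add: ins_def)
next
  assume "\<exists>p\<le>length \<sigma>. \<tau> = ins p \<sigma>"
  then show "max_insertion \<sigma> \<tau>"
    unfolding max_insertion_def ins_def by (metis Suc_eq_plus1 append_take_drop_id)
qed

section \<open>Pattern avoidance under insertion\<close>

text \<open>Sends a position of \<sigma> to the position of the same entry in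
  \<open>ins p \<sigma>\<close>; \<open>down\<close> inverts it away from \<open>p\<close>.\<close>

definition up :: "nat \<Rightarrow> nat \<Rightarrow> nat" where
  "up p x = (if x < p then x else Suc x)"

definition down :: "nat \<Rightarrow> nat \<Rightarrow> nat" where
  "down p x = (if x < p then x else x - 1)"

lemma ins_nth_self: "p \<le> length \<sigma> \<Longrightarrow> ins p \<sigma> ! p = Suc (length \<sigma>)"
  by (simp add: ins_nth)

lemma ins_nth_up: "p \<le> length \<sigma> \<Longrightarrow> ins p \<sigma> ! up p x = \<sigma> ! x"
  by (auto simp: ins_nth up_def)

lemma ins_nth_down: "p \<le> length \<sigma> \<Longrightarrow> x \<noteq> p \<Longrightarrow> ins p \<sigma> ! x = \<sigma> ! down p x"
  by (auto simp: ins_nth down_def)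

lemma up_less_iff: "up p x < up p y \<longleftrightarrow> x < y"
  by (auto simp: up_def)

lemma up_less_length: "p \<le> n \<Longrightarrow> up p x < Suc n \<longleftrightarrow> x < n"
  by (auto simp: up_def)

lemma down_less: "x \<noteq> p \<Longrightarrow> y \<noteq> p \<Longrightarrow> x < y \<Longrightarrow> down p x < down p y"
  by (auto simp: down_def)

lemma down_less_length: "p \<le> n \<Longrightarrow> x \<noteq> p \<Longrightarrow> x < Suc n \<Longrightarrow> down p x < n"
  by (auto simp: down_def)

text \<open>The new maximum can only be the 4 of an occurrence, and then the 1 is the old entry at
  \<open>p\<close>. An old occurrence survives unless the insertion splits its pair 41; in that case
  the new maximum takes over as the 4.\<close>

lemma avoids_2_41_3_ins:
  assumes \<sigma>: "is_perm \<sigma>" and p: "p \<le> length \<sigma>"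
  shows "avoids_2_41_3 (ins p \<sigma>) \<longleftrightarrow> avoids_2_41_3 \<sigma> \<and>
    \<not> (\<exists>i k. i < p \<and> p < k \<and> k < length \<sigma> \<and> \<sigma> ! p < \<sigma> ! i \<and> \<sigma> ! i < \<sigma> ! k)"
    (is "?A \<longleftrightarrow> ?B \<and> \<not> ?C")
proof (intro iffI conjI)
  assume A: ?A
  show nC: "\<not> ?C"
  proof
    assume ?C
    then obtain i k where ik: "i < p" "p < k" "k < length \<sigma>" "\<sigma> ! p < \<sigma> ! i" "\<sigma> ! i < \<sigma> ! k"
      by blast
    have "\<sigma> ! k \<le> length \<sigma>" using \<sigma> ik is_perm_nth_le by blast
    with ik p have "i < p \<and> p + 1 < Suc k \<and> Suc k < length (ins p \<sigma>) \<and>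
      ins p \<sigma> ! (p + 1) < ins p \<sigma> ! i \<and> ins p \<sigma> ! i < ins p \<sigma> ! Suc k \<and> ins p \<sigma> ! Suc k < ins p \<sigma> ! p"
      by (simp add: ins_nth)
    with A show False unfolding avoids_2_41_3_def by blast
  qed
  show ?B
    unfolding avoids_2_41_3_def
  proof
    assume "\<exists>i j k. i < j \<and> j + 1 < k \<and> k < length \<sigma> \<and>
          \<sigma> ! (j + 1) < \<sigma> ! i \<and> \<sigma> ! i < \<sigma> ! k \<and> \<sigma> ! k < \<sigma> ! j"
    then obtain i j k where ijk: "i < j" "j + 1 < k" "k < length \<sigma>"
      "\<sigma> ! (j + 1) < \<sigma> ! i" "\<sigma> ! i < \<sigma> ! k" "\<sigma> ! k < \<sigma> ! j" by blast
    show False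
    proof (cases "p = j + 1")
      case True
      with nC ijk show False by auto
    next
      case False
      then have "up p (j + 1) = up p j + 1" by (auto simp: up_def)
      with ijk p have "up p i < up p j \<and> up p j + 1 < up p k \<and> up p k < length (ins p \<sigma>) \<and>
        ins p \<sigma> ! (up p j + 1) < ins p \<sigma> ! up p i \<and> ins p \<sigma> ! up p i < ins p \<sigma> ! up p k \<and>
        ins p \<sigma> ! up p k < ins p \<sigma> ! up p j"
        by (metis ins_nth_up length_ins up_less_iff up_less_length)
      with A show False unfolding avoids_2_41_3_def by blast
    qed
  qed
next
  assume BC: "?B \<and> \<not> ?C"
  show ?A
    unfolding avoids_2_41_3_def
  proof
    assume "\<exists>i j k. i < j \<and> j + 1 < k \<and> k < length (ins p \<sigma>) \<and>
          ins p \<sigma> ! (j + 1) < ins p \<sigma> ! i \<and> ins p \<sigma> ! i < ins p \<sigma> ! k \<and> ins p \<sigma> ! k < ins p \<sigma> ! j"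
    then obtain i j k where ijk: "i < j" "j + 1 < k" "k < Suc (length \<sigma>)"
      "ins p \<sigma> ! (j + 1) < ins p \<sigma> ! i" "ins p \<sigma> ! i < ins p \<sigma> ! k" "ins p \<sigma> ! k < ins p \<sigma> ! j"
      using p by auto
    have le: "ins p \<sigma> ! x \<le> Suc (length \<sigma>)" if "x < Suc (length \<sigma>)" for x
      using is_perm_nth_le[of "ins p \<sigma>" x] \<sigma> p that by (simp add: is_perm_ins)
    have self: "ins p \<sigma> ! p = Suc (length \<sigma>)" by (rule ins_nth_self[OF p])
    \<comment> \<open>These three entries are smaller than another entry of the occurrence, so none
      is the maximum.\<close>
    have ne: "i \<noteq> p" "j + 1 \<noteq> p" "k \<noteq> p"
      using ijk le[of i] le[of j] le[of k] self by auto
    show False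
    proof (cases "j = p")
      case True
      with ijk p have "i < p \<and> p < k - 1 \<and> k - 1 < length \<sigma> \<and> \<sigma> ! p < \<sigma> ! i \<and> \<sigma> ! i < \<sigma> ! (k - 1)"
        by (auto simp: ins_nth)
      with BC show False by blast
    next
      case False
      with ne have "down p (j + 1) = down p j + 1" by (auto simp: down_def)
      then have "down p i < down p j \<and> down p j + 1 < down p k \<and> down p k < length \<sigma> \<and>
        \<sigma> ! (down p j + 1) < \<sigma> ! down p i \<and> \<sigma> ! down p i < \<sigma> ! down p k \<and> \<sigma> ! down p k < \<sigma> ! down p j"
        using False ne ijk p by (metis ins_nth_down down_less down_less_length)
      with BC show False unfolding avoids_2_41_3_def by blast
    qed
  qed
qed

text \<open>Here too the new maximum can only be the 4, now with the entry at \<open>p - 1\<close>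
  as the 1. If the insertion splits an old pair 14, the new maximum replaces the old 4.\<close>

lemma avoids_3_14_2_ins:
  assumes \<sigma>: "is_perm \<sigma>" and p: "p \<le> length \<sigma>"
  shows "avoids_3_14_2 (ins p \<sigma>) \<longleftrightarrow> avoids_3_14_2 \<sigma> \<and>
    \<not> (\<exists>i k. i + 1 < p \<and> p \<le> k \<and> k < length \<sigma> \<and> \<sigma> ! (p - 1) < \<sigma> ! k \<and> \<sigma> ! k < \<sigma> ! i)"
    (is "?A \<longleftrightarrow> ?B \<and> \<not> ?C")
proof (intro iffI conjI)
  assume A: ?A
  show nC: "\<not> ?C"
  proof
    assume ?C
    then obtain i k where ik: "i + 1 < p" "p \<le> k" "k < length \<sigma>" "\<sigma> ! (p - 1) < \<sigma> ! k" "\<sigma> ! k < \<sigma> ! i"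
      by blast
    have "\<sigma> ! i \<le> length \<sigma>" using \<sigma> ik is_perm_nth_le by (metis add_lessD1 less_le_trans order_less_trans)
    with ik p have "i < p - 1 \<and> p - 1 + 1 < Suc k \<and> Suc k < length (ins p \<sigma>) \<and>
      ins p \<sigma> ! (p - 1) < ins p \<sigma> ! Suc k \<and> ins p \<sigma> ! Suc k < ins p \<sigma> ! i \<and>
      ins p \<sigma> ! i < ins p \<sigma> ! (p - 1 + 1)"
      by (simp add: ins_nth)
    with A show False unfolding avoids_3_14_2_def by blast
  qed
  show ?B
    unfolding avoids_3_14_2_def
  proof
    assume "\<exists>i j k. i < j \<and> j + 1 < k \<and> k < length \<sigma> \<and>
          \<sigma> ! j < \<sigma> ! k \<and> \<sigma> ! k < \<sigma> ! i \<and> \<sigma> ! i < \<sigma> ! (j + 1)"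
    then obtain i j k where ijk: "i < j" "j + 1 < k" "k < length \<sigma>"
      "\<sigma> ! j < \<sigma> ! k" "\<sigma> ! k < \<sigma> ! i" "\<sigma> ! i < \<sigma> ! (j + 1)" by blast
    show False
    proof (cases "p = j + 1")
      case True
      with ijk have "i + 1 < p \<and> p \<le> k \<and> k < length \<sigma> \<and> \<sigma> ! (p - 1) < \<sigma> ! k \<and> \<sigma> ! k < \<sigma> ! i"
        by auto
      with nC show False by blast
    next
      case False
      then have "up p (j + 1) = up p j + 1" by (auto simp: up_def)
      with ijk p have "up p i < up p j \<and> up p j + 1 < up p k \<and> up p k < length (ins p \<sigma>) \<and>
        ins p \<sigma> ! up p j < ins p \<sigma> ! up p k \<and> ins p \<sigma> ! up p k < ins p \<sigma> ! up p i \<and>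
        ins p \<sigma> ! up p i < ins p \<sigma> ! (up p j + 1)"
        by (metis ins_nth_up length_ins up_less_iff up_less_length)
      with A show False unfolding avoids_3_14_2_def by blast
    qed
  qed
next
  assume BC: "?B \<and> \<not> ?C"
  show ?A
    unfolding avoids_3_14_2_def
  proof
    assume "\<exists>i j k. i < j \<and> j + 1 < k \<and> k < length (ins p \<sigma>) \<and>
          ins p \<sigma> ! j < ins p \<sigma> ! k \<and> ins p \<sigma> ! k < ins p \<sigma> ! i \<and> ins p \<sigma> ! i < ins p \<sigma> ! (j + 1)"
    then obtain i j k where ijk: "i < j" "j + 1 < k" "k < Suc (length \<sigma>)"
      "ins p \<sigma> ! j < ins p \<sigma> ! k" "ins p \<sigma> ! k < ins p \<sigma> ! i" "ins p \<sigma> ! i < ins p \<sigma> ! (j + 1)"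
      using p by auto
    have le: "ins p \<sigma> ! x \<le> Suc (length \<sigma>)" if "x < Suc (length \<sigma>)" for x
      using is_perm_nth_le[of "ins p \<sigma>" x] \<sigma> p that by (simp add: is_perm_ins)
    have self: "ins p \<sigma> ! p = Suc (length \<sigma>)" by (rule ins_nth_self[OF p])
    have ne: "i \<noteq> p" "j \<noteq> p" "k \<noteq> p"
      using ijk le[of i] le[of "j + 1"] le[of k] self by auto
    show False
    proof (cases "j + 1 = p")
      case True
      with ijk p have "i + 1 < p \<and> p \<le> k - 1 \<and> k - 1 < length \<sigma> \<and>
        \<sigma> ! (p - 1) < \<sigma> ! (k - 1) \<and> \<sigma> ! (k - 1) < \<sigma> ! i"
        by (auto simp: ins_nth split: if_splits)
      with BC show False by blast
    next
      case False
      with ne have "down p (j + 1) = down p j + 1" by (auto simp: down_def)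
      then have "down p i < down p j \<and> down p j + 1 < down p k \<and> down p k < length \<sigma> \<and>
        \<sigma> ! down p j < \<sigma> ! down p k \<and> \<sigma> ! down p k < \<sigma> ! down p i \<and> \<sigma> ! down p i < \<sigma> ! (down p j + 1)"
        using False ne ijk p by (metis ins_nth_down down_less down_less_length)
      with BC show False unfolding avoids_3_14_2_def by blast
    qed
  qed
qed

section \<open>The two patterns with consecutive values\<close>

text \<open>A new maximum in front of position \<open>p\<close> completes \<open>41323\<^sup>+\<close> or \<open>42313\<^sup>+\<close>
  exactly when \<open>blocked \<sigma> p\<close> holds.\<close>

definition blocked :: "nat list \<Rightarrow> nat \<Rightarrow> bool" where
  "blocked \<sigma> p \<longleftrightarrow> (\<exists>b c d e. p \<le> b \<and> b < c \<and> c < d \<and> d < e \<and> e < length \<sigma> \<and>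
    \<sigma> ! b < \<sigma> ! c \<and> \<sigma> ! d < \<sigma> ! c \<and> \<sigma> ! e = \<sigma> ! c + 1)"

lemma blocked_mono: "blocked \<sigma> y \<Longrightarrow> x \<le> y \<Longrightarrow> blocked \<sigma> x"
  unfolding blocked_def by (meson le_trans)

text \<open>Both patterns in one: they differ only in the order of the values at \<open>b\<close>
  and \<open>d\<close>, which are distinct in a permutation.\<close>

definition avoids_plus :: "nat list \<Rightarrow> bool" where
  "avoids_plus \<sigma> \<longleftrightarrow> \<not> (\<exists>a b c d e. a < b \<and> b < c \<and> c < d \<and> d < e \<and> e < length \<sigma> \<and>
    \<sigma> ! b < \<sigma> ! c \<and> \<sigma> ! d < \<sigma> ! c \<and> \<sigma> ! e = \<sigma> ! c + 1 \<and> \<sigma> ! e < \<sigma> ! a)"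

lemma avoids_plus_iff:
  assumes "is_perm \<sigma>"
  shows "avoids_plus \<sigma> \<longleftrightarrow> avoids_41323_plus \<sigma> \<and> avoids_42313_plus \<sigma>"
proof
  show "avoids_plus \<sigma> \<Longrightarrow> avoids_41323_plus \<sigma> \<and> avoids_42313_plus \<sigma>"
    unfolding avoids_plus_def avoids_41323_plus_def avoids_42313_plus_def
    by (meson order_less_trans)
next
  assume *: "avoids_41323_plus \<sigma> \<and> avoids_42313_plus \<sigma>"
  show "avoids_plus \<sigma>"
    unfolding avoids_plus_def
  proof
    assume "\<exists>a b c d e. a < b \<and> b < c \<and> c < d \<and> d < e \<and> e < length \<sigma> \<and>
      \<sigma> ! b < \<sigma> ! c \<and> \<sigma> ! d < \<sigma> ! c \<and> \<sigma> ! e = \<sigma> ! c + 1 \<and> \<sigma> ! e < \<sigma> ! a"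
    then obtain a b c d e where h: "a < b" "b < c" "c < d" "d < e" "e < length \<sigma>"
      "\<sigma> ! b < \<sigma> ! c" "\<sigma> ! d < \<sigma> ! c" "\<sigma> ! e = \<sigma> ! c + 1" "\<sigma> ! e < \<sigma> ! a" by blast
    have "\<sigma> ! b \<noteq> \<sigma> ! d" using is_perm_nth_inj[OF assms, of b d] h by auto
    then consider "\<sigma> ! b < \<sigma> ! d" | "\<sigma> ! d < \<sigma> ! b" by linarith
    then show False
      using * h unfolding avoids_41323_plus_def avoids_42313_plus_def by cases blast+
  qed
qed

text \<open>Every entry of an occurrence except the one at \<open>a\<close> lies below another, so
  the new maximum can only stand at \<open>a\<close>, leaving an obstruction behind it. Old
  occurrences survive: no positions need be adjacent, and the relation between the values at
  \<open>c\<close> and \<open>e\<close> is unchanged.\<close>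

lemma avoids_plus_ins:
  assumes \<sigma>: "is_perm \<sigma>" and p: "p \<le> length \<sigma>"
  shows "avoids_plus (ins p \<sigma>) \<longleftrightarrow> avoids_plus \<sigma> \<and> \<not> blocked \<sigma> p"
proof (intro iffI conjI)
  assume A: "avoids_plus (ins p \<sigma>)"
  show "\<not> blocked \<sigma> p"
  proof
    assume "blocked \<sigma> p"
    then obtain b c d e where h: "p \<le> b" "b < c" "c < d" "d < e" "e < length \<sigma>"
      "\<sigma> ! b < \<sigma> ! c" "\<sigma> ! d < \<sigma> ! c" "\<sigma> ! e = \<sigma> ! c + 1" unfolding blocked_def by blast
    have "\<sigma> ! e \<le> length \<sigma>" using \<sigma> h is_perm_nth_le by blast
    with h p have "p < Suc b \<and> Suc b < Suc c \<and> Suc c < Suc d \<and> Suc d < Suc e \<and> Suc e < length (ins p \<sigma>) \<and>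
      ins p \<sigma> ! Suc b < ins p \<sigma> ! Suc c \<and> ins p \<sigma> ! Suc d < ins p \<sigma> ! Suc c \<and>
      ins p \<sigma> ! Suc e = ins p \<sigma> ! Suc c + 1 \<and> ins p \<sigma> ! Suc e < ins p \<sigma> ! p"
      by (simp add: ins_nth)
    with A show False unfolding avoids_plus_def by blast
  qed
  show "avoids_plus \<sigma>"
    unfolding avoids_plus_def
  proof
    assume "\<exists>a b c d e. a < b \<and> b < c \<and> c < d \<and> d < e \<and> e < length \<sigma> \<and>
      \<sigma> ! b < \<sigma> ! c \<and> \<sigma> ! d < \<sigma> ! c \<and> \<sigma> ! e = \<sigma> ! c + 1 \<and> \<sigma> ! e < \<sigma> ! a"
    then obtain a b c d e where "a < b" "b < c" "c < d" "d < e" "e < length \<sigma>"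
      "\<sigma> ! b < \<sigma> ! c" "\<sigma> ! d < \<sigma> ! c" "\<sigma> ! e = \<sigma> ! c + 1" "\<sigma> ! e < \<sigma> ! a" by blast
    then have "up p a < up p b \<and> up p b < up p c \<and> up p c < up p d \<and> up p d < up p e \<and>
      up p e < length (ins p \<sigma>) \<and>
      ins p \<sigma> ! up p b < ins p \<sigma> ! up p c \<and> ins p \<sigma> ! up p d < ins p \<sigma> ! up p c \<and>
      ins p \<sigma> ! up p e = ins p \<sigma> ! up p c + 1 \<and> ins p \<sigma> ! up p e < ins p \<sigma> ! up p a"
      using p by (simp add: ins_nth_up up_less_iff up_less_length)
    with A show False unfolding avoids_plus_def by blast
  qed
next
  assume B: "avoids_plus \<sigma> \<and> \<not> blocked \<sigma> p"
  show "avoids_plus (ins p \<sigma>)"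
    unfolding avoids_plus_def
  proof
    assume "\<exists>a b c d e. a < b \<and> b < c \<and> c < d \<and> d < e \<and> e < length (ins p \<sigma>) \<and>
      ins p \<sigma> ! b < ins p \<sigma> ! c \<and> ins p \<sigma> ! d < ins p \<sigma> ! c \<and>
      ins p \<sigma> ! e = ins p \<sigma> ! c + 1 \<and> ins p \<sigma> ! e < ins p \<sigma> ! a"
    then obtain a b c d e where h: "a < b" "b < c" "c < d" "d < e" "e < Suc (length \<sigma>)"
      "ins p \<sigma> ! b < ins p \<sigma> ! c" "ins p \<sigma> ! d < ins p \<sigma> ! c"
      "ins p \<sigma> ! e = ins p \<sigma> ! c + 1" "ins p \<sigma> ! e < ins p \<sigma> ! a"
      using p by auto
    have le: "ins p \<sigma> ! x \<le> Suc (length \<sigma>)" if "x < Suc (length \<sigma>)" for x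
      using is_perm_nth_le[of "ins p \<sigma>" x] \<sigma> p that by (simp add: is_perm_ins)
    have ne: "b \<noteq> p" "c \<noteq> p" "d \<noteq> p" "e \<noteq> p"
      using h le[of a] le[of c] le[of e] ins_nth_self[OF p] by auto
    have m: "down p b < down p c" "down p c < down p d" "down p d < down p e" "down p e < length \<sigma>"
      "\<sigma> ! down p b < \<sigma> ! down p c" "\<sigma> ! down p d < \<sigma> ! down p c" "\<sigma> ! down p e = \<sigma> ! down p c + 1"
      using ne h p by (metis ins_nth_down down_less down_less_length)+
    show False
    proof (cases "a = p")
      case True
      then have "p \<le> down p b" using h by (simp add: down_def)
      with m B show False unfolding blocked_def by blast
    next
      case False
      then have "down p a < down p b" "\<sigma> ! down p e < \<sigma> ! down p a"
        using ne h p by (metis ins_nth_down down_less)+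
      with m B show False unfolding avoids_plus_def by blast
    qed
  qed
qed

section \<open>Active sites\<close>

definition left_sites :: "nat list \<Rightarrow> nat set" where
  "left_sites \<sigma> = {x. x < length \<sigma> \<and> (\<forall>i<x. \<sigma> ! i < \<sigma> ! x) \<and> \<not> blocked \<sigma> x}"

text \<open>A right site is stored as the position \<open>x\<close> of the right-to-left maximum, so
  its insertion point is \<open>Suc x\<close>; a left site is its own insertion point.\<close>

definition right_sites :: "nat list \<Rightarrow> nat set" where
  "right_sites \<sigma> = {x. x < length \<sigma> \<and> (\<forall>i. x < i \<and> i < length \<sigma> \<longrightarrow> \<sigma> ! i < \<sigma> ! x)}"

definition site_label :: "nat list \<Rightarrow> nat \<times> nat" where
  "site_label \<sigma> = (card (left_sites \<sigma>), card (right_sites \<sigma>))"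

lemma finite_left_sites [simp]: "finite (left_sites \<sigma>)"
  by (simp add: left_sites_def)

lemma finite_right_sites [simp]: "finite (right_sites \<sigma>)"
  by (simp add: right_sites_def)

lemma S_class_iff:
  "\<sigma> \<in> S_class \<longleftrightarrow> \<sigma> \<noteq> [] \<and> is_perm \<sigma> \<and> avoids_2_41_3 \<sigma> \<and> avoids_3_14_2 \<sigma> \<and> avoids_plus \<sigma>"
proof -
  have "(\<exists>n\<ge>1. \<sigma> \<in> permutations_of_set {1..n}) \<longleftrightarrow> \<sigma> \<noteq> [] \<and> is_perm \<sigma>"
  proof
    assume "\<exists>n\<ge>1. \<sigma> \<in> permutations_of_set {1..n}"
    then obtain n where n: "n \<ge> 1" "\<sigma> \<in> permutations_of_set {1..n}" by blast
    then have "length \<sigma> = n" by (simp add: length_finite_permutations_of_set)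
    with n show "\<sigma> \<noteq> [] \<and> is_perm \<sigma>" by (auto simp: is_perm_permutations_of_set)
  next
    assume "\<sigma> \<noteq> [] \<and> is_perm \<sigma>"
    then show "\<exists>n\<ge>1. \<sigma> \<in> permutations_of_set {1..n}"
      by (intro exI[of _ "length \<sigma>"]) (auto simp: is_perm_permutations_of_set Suc_le_eq)
  qed
  then show ?thesis
    unfolding S_class_def using avoids_plus_iff by auto
qed

lemma is_perm_max_position:
  assumes "is_perm \<sigma>" "\<sigma> \<noteq> []"
  obtains q where "q < length \<sigma>" "\<sigma> ! q = length \<sigma>"
proof -
  have "length \<sigma> \<in> set \<sigma>" using assms by (simp add: is_perm_def Suc_le_eq)
  then show ?thesis using that by (metis in_set_conv_nth)
qed

text \<open>The position \<open>q\<close> of the maximum separates the two kinds of site: left sites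
  are at most \<open>q\<close>, right sites at least \<open>q\<close>.\<close>

locale max_at =
  fixes \<sigma> :: "nat list" and q :: nat
  assumes perm: "is_perm \<sigma>" and q_less: "q < length \<sigma>" and nth_q: "\<sigma> ! q = length \<sigma>"
begin

lemma nth_less: "x < length \<sigma> \<Longrightarrow> x \<noteq> q \<Longrightarrow> \<sigma> ! x < length \<sigma>"
  using is_perm_nth_le[OF perm, of x] is_perm_nth_inj[OF perm, of x q] q_less nth_q
  by (metis nat_less_le)

lemma nth_neq: "x < length \<sigma> \<Longrightarrow> y < length \<sigma> \<Longrightarrow> x \<noteq> y \<Longrightarrow> \<sigma> ! x \<noteq> \<sigma> ! y"
  using is_perm_nth_inj[OF perm] by blast

lemma left_sites_le: "x \<in> left_sites \<sigma> \<Longrightarrow> x \<le> q"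
  unfolding left_sites_def using is_perm_nth_le[OF perm, of x] nth_q
  by (metis (mono_tags, lifting) leD leI mem_Collect_eq)

lemma right_sites_ge: "x \<in> right_sites \<sigma> \<Longrightarrow> q \<le> x"
  unfolding right_sites_def using is_perm_nth_le[OF perm, of x] nth_q q_less
  by (metis (mono_tags, lifting) leD leI mem_Collect_eq)

text \<open>An obstruction from \<open>q\<close> on would lie strictly behind the maximum, which
  would complete it to a forbidden pattern.\<close>

lemma not_blocked_max:
  assumes "avoids_plus \<sigma>"
  shows "\<not> blocked \<sigma> q"
proof
  assume "blocked \<sigma> q"
  then obtain b c d e where h: "q \<le> b" "b < c" "c < d" "d < e" "e < length \<sigma>"
    "\<sigma> ! b < \<sigma> ! c" "\<sigma> ! d < \<sigma> ! c" "\<sigma> ! e = \<sigma> ! c + 1" unfolding blocked_def by blast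
  have "\<sigma> ! c < length \<sigma>" "\<sigma> ! e < length \<sigma>" using h nth_less[of c] nth_less[of e] by auto
  then have "q \<noteq> b" "\<sigma> ! e < \<sigma> ! q" using h nth_q by auto
  with h assms show False unfolding avoids_plus_def by (metis le_neq_implies_less)
qed

lemma max_in_left_sites: "avoids_plus \<sigma> \<Longrightarrow> q \<in> left_sites \<sigma>"
  using not_blocked_max q_less nth_q nth_less by (simp add: left_sites_def)

lemma max_in_right_sites: "q \<in> right_sites \<sigma>"
  using q_less nth_q nth_less by (simp add: right_sites_def)

text \<open>In a new obstruction the new maximum can only be the entry at \<open>e\<close>, which
  forces \<open>c = q\<close>. Then \<open>b\<close> needs room between \<open>x\<close> and
  \<open>q\<close>, and \<open>d\<close> needs room between \<open>q\<close> and
  \<open>p\<close>.\<close>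

lemma blocked_ins:
  assumes p: "p \<le> length \<sigma>" and x: "x \<le> p"
  shows "blocked (ins p \<sigma>) x \<longleftrightarrow> blocked \<sigma> x \<or> x < q \<and> q + 1 < p"
proof
  assume "blocked (ins p \<sigma>) x"
  then obtain b c d e where h: "x \<le> b" "b < c" "c < d" "d < e" "e < Suc (length \<sigma>)"
    "ins p \<sigma> ! b < ins p \<sigma> ! c" "ins p \<sigma> ! d < ins p \<sigma> ! c" "ins p \<sigma> ! e = ins p \<sigma> ! c + 1"
    unfolding blocked_def using p by auto
  have le: "ins p \<sigma> ! y \<le> Suc (length \<sigma>)" if "y < Suc (length \<sigma>)" for y
    using is_perm_nth_le[of "ins p \<sigma>" y] perm p that by (simp add: is_perm_ins)
  have ne: "b \<noteq> p" "c \<noteq> p" "d \<noteq> p"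
    using h le[of c] le[of e] ins_nth_self[OF p] by auto
  show "blocked \<sigma> x \<or> x < q \<and> q + 1 < p"
  proof (cases "e = p")
    case True
    then have "\<sigma> ! c = length \<sigma>" using h p by (simp add: ins_nth)
    then have "c = q" using nth_less[of c] h True p by fastforce
    then show ?thesis using h True by simp
  next
    case False
    have m: "down p b < down p c" "down p c < down p d" "down p d < down p e" "down p e < length \<sigma>"
      "\<sigma> ! down p b < \<sigma> ! down p c" "\<sigma> ! down p d < \<sigma> ! down p c" "\<sigma> ! down p e = \<sigma> ! down p c + 1"
      using ne False h p by (metis ins_nth_down down_less down_less_length)+
    moreover have "x \<le> down p b" using x h ne by (auto simp: down_def)
    ultimately show ?thesis unfolding blocked_def by blast
  qed
next
  assume "blocked \<sigma> x \<or> x < q \<and> q + 1 < p"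
  then show "blocked (ins p \<sigma>) x"
  proof
    assume "blocked \<sigma> x"
    then obtain b c d e where h: "x \<le> b" "b < c" "c < d" "d < e" "e < length \<sigma>"
      "\<sigma> ! b < \<sigma> ! c" "\<sigma> ! d < \<sigma> ! c" "\<sigma> ! e = \<sigma> ! c + 1" unfolding blocked_def by blast
    have "x \<le> up p b" using h by (simp add: up_def)
    with h have "x \<le> up p b \<and> up p b < up p c \<and> up p c < up p d \<and> up p d < up p e \<and>
      up p e < length (ins p \<sigma>) \<and>
      ins p \<sigma> ! up p b < ins p \<sigma> ! up p c \<and> ins p \<sigma> ! up p d < ins p \<sigma> ! up p c \<and>
      ins p \<sigma> ! up p e = ins p \<sigma> ! up p c + 1"
      using p by (simp add: ins_nth_up up_less_iff up_less_length)
    then show ?thesis unfolding blocked_def by blast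
  next
    assume h: "x < q \<and> q + 1 < p"
    have "\<sigma> ! x < length \<sigma>" "\<sigma> ! (q + 1) < length \<sigma>" using h nth_less p by auto
    \<comment> \<open>The witnesses are \<open>b = x\<close>, \<open>c = q\<close>,
      \<open>d = q + 1\<close> and \<open>e = p\<close>.\<close>
    with h p have "x \<le> x \<and> x < q \<and> q < q + 1 \<and> q + 1 < p \<and> p < length (ins p \<sigma>) \<and>
      ins p \<sigma> ! x < ins p \<sigma> ! q \<and> ins p \<sigma> ! (q + 1) < ins p \<sigma> ! q \<and> ins p \<sigma> ! p = ins p \<sigma> ! q + 1"
      using nth_q by (simp add: ins_nth)
    then show ?thesis unfolding blocked_def by blast
  qed
qed

text \<open>Left-to-right maxima behind the new maximum are lost, and those in front remain unless
  \<open>blocked_ins\<close> removes them. The new maximum is itself one, and nothing new can block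
  the site before it.\<close>

lemma left_sites_ins:
  assumes p: "p \<le> length \<sigma>"
  shows "left_sites (ins p \<sigma>) =
    {x \<in> left_sites \<sigma>. x < p \<and> \<not> (x < q \<and> q + 1 < p)} \<union> (if blocked \<sigma> p then {} else {p})"
proof (rule set_eqI)
  fix x
  consider "x < p" | "x = p" | "p < x" by linarith
  then show "x \<in> left_sites (ins p \<sigma>) \<longleftrightarrow> x \<in> {x \<in> left_sites \<sigma>. x < p \<and> \<not> (x < q \<and> q + 1 < p)} \<union>
    (if blocked \<sigma> p then {} else {p})"
  proof cases
    case 1
    then show ?thesis using p blocked_ins[OF p, of x] by (auto simp: left_sites_def ins_nth)
  next
    case 2
    have "\<forall>i<p. \<sigma> ! i < Suc (length \<sigma>)"
      using is_perm_nth_le[OF perm] p by (simp add: less_Suc_eq_le)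
    then show ?thesis using p blocked_ins[OF p, of p] 2 by (auto simp: left_sites_def ins_nth)
  next
    case 3
    have "\<not> (\<forall>i<x. ins p \<sigma> ! i < ins p \<sigma> ! x)" if "x < Suc (length \<sigma>)"
      using is_perm_nth_le[of "ins p \<sigma>" x] perm p 3 that ins_nth_self[OF p]
      by (metis is_perm_ins leD length_ins)
    then show ?thesis using 3 p by (auto simp: left_sites_def)
  qed
qed

text \<open>The new maximum hides every right-to-left maximum in front of it; those behind it move
  one position to the right.\<close>

lemma right_sites_ins:
  assumes p: "p \<le> length \<sigma>"
  shows "right_sites (ins p \<sigma>) = insert p (Suc ` {x \<in> right_sites \<sigma>. p \<le> x})"
proof (rule set_eqI)
  fix x
  have le: "y < Suc (length \<sigma>) \<Longrightarrow> y \<noteq> p \<Longrightarrow> ins p \<sigma> ! y < ins p \<sigma> ! p" for y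
    using is_perm_nth_le[OF perm, of "down p y"] down_less_length[OF p, of y] p
    by (simp add: ins_nth_down ins_nth_self)
  consider "x < p" | "x = p" | y where "p \<le> y" "x = Suc y"
    by (metis Suc_le_D Suc_le_mono linorder_neqE_nat Suc_leI)
  then show "x \<in> right_sites (ins p \<sigma>) \<longleftrightarrow> x \<in> insert p (Suc ` {x \<in> right_sites \<sigma>. p \<le> x})"
  proof cases
    case 1
    then have "ins p \<sigma> ! x < ins p \<sigma> ! p" using le p by simp
    then have "x \<notin> right_sites (ins p \<sigma>)"
      using 1 p by (auto simp: right_sites_def intro!: exI[of _ p])
    then show ?thesis using 1 by auto
  next
    case 2
    then show ?thesis using p le by (auto simp: right_sites_def)
  next
    case 3
    have "x \<in> right_sites (ins p \<sigma>) \<longleftrightarrow> y < length \<sigma> \<and>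
        (\<forall>i. Suc y < i \<and> i < Suc (length \<sigma>) \<longrightarrow> \<sigma> ! (i - 1) < \<sigma> ! y)"
      using 3 p by (auto simp: right_sites_def ins_nth)
    also have "\<dots> \<longleftrightarrow> y \<in> right_sites \<sigma>"
    proof -
      have "(\<forall>i. Suc y < i \<and> i < Suc (length \<sigma>) \<longrightarrow> \<sigma> ! (i - 1) < \<sigma> ! y) \<longleftrightarrow>
          (\<forall>i. y < i \<and> i < length \<sigma> \<longrightarrow> \<sigma> ! i < \<sigma> ! y)" (is "?A \<longleftrightarrow> ?B")
      proof
        assume A: ?A
        show ?B using spec[OF A, of "Suc i" for i] by simp
      next
        assume B: ?B
        show ?A using spec[OF B, of "i - 1" for i] by (auto simp: less_diff_conv)
      qed
      then show ?thesis by (simp add: right_sites_def)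
    qed
    finally show ?thesis using 3 by auto
  qed
qed

end

section \<open>Which insertions stay in the class\<close>

lemma S_class_max_at:
  assumes "\<sigma> \<in> S_class"
  obtains q where "max_at \<sigma> q"
  using assms is_perm_max_position[of \<sigma>] by (auto simp: S_class_iff max_at_def)

text \<open>Up to \<open>q\<close>, the old maximum serves as the 3 of \<open>2_41_3\<close>, so
  \<open>p\<close> must be a left-to-right maximum. Behind \<open>q\<close> it serves as the 3 of
  \<open>3_14_2\<close>, so \<open>p - 1\<close> must be a right-to-left maximum. The other
  adjacency condition then holds because \<sigma> avoids that pattern.\<close>

lemma ins_mem_S_class:
  assumes \<sigma>: "\<sigma> \<in> S_class" and p: "p \<le> length \<sigma>"
  shows "ins p \<sigma> \<in> S_class \<longleftrightarrow> p \<in> left_sites \<sigma> \<or> (\<exists>x\<in>right_sites \<sigma>. p = Suc x)"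
proof -
  obtain q where "max_at \<sigma> q" using S_class_max_at[OF \<sigma>] .
  then interpret max_at \<sigma> q .
  from \<sigma> have av: "avoids_2_41_3 \<sigma>" "avoids_3_14_2 \<sigma>" "avoids_plus \<sigma>" "\<sigma> \<noteq> []"
    by (simp_all add: S_class_iff)
  let ?C1 = "\<exists>i k. i < p \<and> p < k \<and> k < length \<sigma> \<and> \<sigma> ! p < \<sigma> ! i \<and> \<sigma> ! i < \<sigma> ! k"
  let ?C2 = "\<exists>i k. i + 1 < p \<and> p \<le> k \<and> k < length \<sigma> \<and> \<sigma> ! (p - 1) < \<sigma> ! k \<and> \<sigma> ! k < \<sigma> ! i"
  have "ins p \<sigma> \<noteq> []" by (simp add: ins_def)
  then have iff: "ins p \<sigma> \<in> S_class \<longleftrightarrow> \<not> ?C1 \<and> \<not> ?C2 \<and> \<not> blocked \<sigma> p"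
    unfolding S_class_iff is_perm_ins[OF p] avoids_2_41_3_ins[OF perm p]
      avoids_3_14_2_ins[OF perm p] avoids_plus_ins[OF perm p]
    using perm av by blast
  show ?thesis
  proof (cases "p \<le> q")
    case True
    then have nR: "\<not> (\<exists>x\<in>right_sites \<sigma>. p = Suc x)" using right_sites_ge by fastforce
    have "\<not> ?C1 \<and> \<not> ?C2 \<and> \<not> blocked \<sigma> p \<longleftrightarrow> p \<in> left_sites \<sigma>"
    proof
      assume h: "\<not> ?C1 \<and> \<not> ?C2 \<and> \<not> blocked \<sigma> p"
      have "\<sigma> ! i < \<sigma> ! p" if "i < p" for i
      proof (rule ccontr)
        assume n: "\<not> \<sigma> ! i < \<sigma> ! p"
        then have "\<sigma> ! p < \<sigma> ! i" using nth_neq[of i p] that True q_less by fastforce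
        moreover have "\<sigma> ! i < \<sigma> ! q" using nth_less[of i] nth_q that True q_less by simp
        ultimately have "p < q" using True by (cases "p = q") auto
        \<comment> \<open>The positions \<open>i\<close>, \<open>p\<close> and \<open>q\<close>
          realise the first forbidden configuration, with \<open>k = q\<close>.\<close>
        with h that \<open>\<sigma> ! p < \<sigma> ! i\<close> \<open>\<sigma> ! i < \<sigma> ! q\<close> q_less show False by blast
      qed
      with h True q_less show "p \<in> left_sites \<sigma>" by (simp add: left_sites_def)
    next
      assume L: "p \<in> left_sites \<sigma>"
      then have lr: "\<And>i. i < p \<Longrightarrow> \<sigma> ! i < \<sigma> ! p" by (simp add: left_sites_def)
      have "\<not> ?C2"
      proof
        assume ?C2
        then obtain i k where ik: "i + 1 < p" "p \<le> k" "k < length \<sigma>"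
          "\<sigma> ! (p - 1) < \<sigma> ! k" "\<sigma> ! k < \<sigma> ! i" by blast
        have i: "\<sigma> ! i < \<sigma> ! p" using lr ik by simp
        with ik have "k \<noteq> p" by auto
        \<comment> \<open>The left-to-right maximum at \<open>p\<close> is the 4 of an occurrence
          that was already in \<sigma>.\<close>
        with ik i have "i < p - 1 \<and> p - 1 + 1 < k \<and> k < length \<sigma> \<and>
          \<sigma> ! (p - 1) < \<sigma> ! k \<and> \<sigma> ! k < \<sigma> ! i \<and> \<sigma> ! i < \<sigma> ! (p - 1 + 1)" by auto
        with av show False unfolding avoids_3_14_2_def by blast
      qed
      moreover have "\<not> ?C1" using lr by (meson not_less_iff_gr_or_eq)
      ultimately show "\<not> ?C1 \<and> \<not> ?C2 \<and> \<not> blocked \<sigma> p" using L by (simp add: left_sites_def)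
    qed
    then show ?thesis using iff nR by blast
  next
    case False
    then obtain x where x: "p = Suc x" "q \<le> x" by (metis Suc_le_D not_less_eq_eq Suc_le_mono)
    have nL: "p \<notin> left_sites \<sigma>" using left_sites_le False by blast
    have nb: "\<not> blocked \<sigma> p" using not_blocked_max[OF av(3)] blocked_mono False by (meson nat_le_linear)
    have "\<not> ?C1 \<and> \<not> ?C2 \<longleftrightarrow> x \<in> right_sites \<sigma>"
    proof
      assume h: "\<not> ?C1 \<and> \<not> ?C2"
      have "\<sigma> ! i < \<sigma> ! x" if i: "x < i" "i < length \<sigma>" for i
      proof (rule ccontr)
        assume n: "\<not> \<sigma> ! i < \<sigma> ! x"
        then have gt: "\<sigma> ! x < \<sigma> ! i" using nth_neq[of i x] i by fastforce
        moreover have lt: "\<sigma> ! i < \<sigma> ! q" using nth_less[of i] nth_q x i by simp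
        ultimately have "q \<noteq> x" by auto
        with x gt lt i have "q + 1 < p \<and> p \<le> i \<and> i < length \<sigma> \<and> \<sigma> ! (p - 1) < \<sigma> ! i \<and> \<sigma> ! i < \<sigma> ! q"
          by auto
        with h show False by blast
      qed
      then show "x \<in> right_sites \<sigma>" using x p by (simp add: right_sites_def)
    next
      assume R: "x \<in> right_sites \<sigma>"
      then have rl: "\<And>i. x < i \<Longrightarrow> i < length \<sigma> \<Longrightarrow> \<sigma> ! i < \<sigma> ! x" by (simp add: right_sites_def)
      have "\<not> ?C1"
      proof
        assume ?C1
        then obtain i k where ik: "i < p" "p < k" "k < length \<sigma>" "\<sigma> ! p < \<sigma> ! i" "\<sigma> ! i < \<sigma> ! k" by blast
        have k: "\<sigma> ! k < \<sigma> ! x" using rl ik x by simp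
        with ik have "i \<noteq> x" by auto
        \<comment> \<open>The right-to-left maximum at \<open>x\<close> is the 4 of an occurrence
          that was already in \<sigma>.\<close>
        with ik k x have "i < x \<and> x + 1 < k \<and> k < length \<sigma> \<and> \<sigma> ! (x + 1) < \<sigma> ! i \<and>
          \<sigma> ! i < \<sigma> ! k \<and> \<sigma> ! k < \<sigma> ! x" by auto
        with av show False unfolding avoids_2_41_3_def by blast
      qed
      moreover have "\<not> ?C2" using rl x by (auto simp: not_less_iff_gr_or_eq Suc_le_eq)
      ultimately show "\<not> ?C1 \<and> \<not> ?C2" by blast
    qed
    then show ?thesis using iff nL nb x by auto
  qed
qed

text \<open>Each insertion criterion includes avoidance by the old permutation, so removing the
  maximum stays in the class.\<close>

lemma ins_mem_S_classD:
  assumes "is_perm \<sigma>" "\<sigma> \<noteq> []" "p \<le> length \<sigma>" "ins p \<sigma> \<in> S_class"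
  shows "\<sigma> \<in> S_class"
  using assms by (simp add: S_class_iff avoids_2_41_3_ins avoids_3_14_2_ins avoids_plus_ins)

section \<open>The labelled children\<close>

text \<open>The right sites are taken from right to left so that the labels come in the order of
  \<open>sch_production\<close>.\<close>

definition S_children :: "nat list \<Rightarrow> nat list list" where
  "S_children \<sigma> = map (\<lambda>p. ins p \<sigma>) (sorted_list_of_set (left_sites \<sigma>)) @
    map (\<lambda>x. ins (Suc x) \<sigma>) (rev (sorted_list_of_set (right_sites \<sigma>)))"

lemma S_children_sites:
  "set (S_children \<sigma>) = (\<lambda>p. ins p \<sigma>) ` (left_sites \<sigma> \<union> Suc ` right_sites \<sigma>)"
  by (auto simp: S_children_def)

lemma set_S_children:
  assumes "\<sigma> \<in> S_class"
  shows "set (S_children \<sigma>) = {\<tau>. (\<sigma>, \<tau>) \<in> tedges S_tree}"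
proof -
  have "p \<le> length \<sigma>" if "p \<in> left_sites \<sigma> \<union> Suc ` right_sites \<sigma>" for p
    using that by (auto simp: left_sites_def right_sites_def)
  then show ?thesis
    using assms ins_mem_S_class[OF assms]
    by (auto simp: S_children_sites S_tree_def max_insertion_iff_ins)
qed

lemma distinct_S_children:
  assumes "\<sigma> \<in> S_class"
  shows "distinct (S_children \<sigma>)"
proof -
  obtain q where "max_at \<sigma> q" using S_class_max_at[OF assms] .
  then interpret max_at \<sigma> q .
  let ?ps = "sorted_list_of_set (left_sites \<sigma>) @ map Suc (rev (sorted_list_of_set (right_sites \<sigma>)))"
  have "left_sites \<sigma> \<inter> Suc ` right_sites \<sigma> = {}"
    using left_sites_le right_sites_ge by fastforce
  then have "distinct ?ps" by (auto simp: distinct_map)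
  moreover have "inj_on (\<lambda>p. ins p \<sigma>) (set ?ps)"
    by (rule inj_onI, rule ins_inj[OF perm]) (auto simp: left_sites_def right_sites_def)
  moreover have "S_children \<sigma> = map (\<lambda>p. ins p \<sigma>) ?ps"
    by (simp add: S_children_def comp_def)
  ultimately show ?thesis by (simp only: distinct_map)
qed

text \<open>The i-th smallest element has rank i. Ranks of left sites become the first coordinates
  of the labels of the left children.\<close>

lemma map_rank_sorted_list_of_set:
  fixes A :: "nat set"
  assumes "finite A"
  shows "map (\<lambda>p. card {x \<in> A. x \<le> p}) (sorted_list_of_set A) = [1..<card A + 1]"
  using assms
proof (induction A rule: finite_linorder_max_induct)
  case (insert b A)
  have "sorted_list_of_set (insert b A) = sorted_list_of_set A @ [b]"
    using insert by (intro sorted_distinct_set_unique) (auto simp: sorted_append less_imp_le simp del: sorted_list_of_set_insert_remove)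
  moreover have "map (\<lambda>p. card {x \<in> insert b A. x \<le> p}) (sorted_list_of_set A) =
      map (\<lambda>p. card {x \<in> A. x \<le> p}) (sorted_list_of_set A)"
  proof (rule map_cong[OF refl])
    fix p assume "p \<in> set (sorted_list_of_set A)"
    then have "{x \<in> insert b A. x \<le> p} = {x \<in> A. x \<le> p}" using insert by force
    then show "card {x \<in> insert b A. x \<le> p} = card {x \<in> A. x \<le> p}" by simp
  qed
  moreover have "card {x \<in> insert b A. x \<le> b} = card A + 1"
  proof -
    have "{x \<in> insert b A. x \<le> b} = insert b A" using insert by force
    moreover have "b \<notin> A" using insert by blast
    ultimately show ?thesis using insert by simp
  qed
  moreover have "card (insert b A) = card A + 1" using insert by (subst card_insert_disjoint) auto
  ultimately show ?case using insert by simp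
qed simp

text \<open>The mirror image, with ranks counted from the top; it gives the second coordinates of
  the labels \<open>(2, j)\<close>.\<close>

lemma map_rank_rev_sorted_list_of_set:
  fixes A :: "nat set"
  assumes "finite A"
  shows "map (\<lambda>p. card {x \<in> A. p \<le> x}) (rev (sorted_list_of_set A)) = [1..<card A + 1]"
  using assms
proof (induction A rule: finite_linorder_min_induct)
  case (insert b A)
  have "sorted_list_of_set (insert b A) = b # sorted_list_of_set A"
    using insert by (intro sorted_distinct_set_unique)
      (auto simp: less_imp_le simp del: sorted_list_of_set_insert_remove)
  moreover have "map (\<lambda>p. card {x \<in> insert b A. p \<le> x}) (rev (sorted_list_of_set A)) =
      map (\<lambda>p. card {x \<in> A. p \<le> x}) (rev (sorted_list_of_set A))"
  proof (rule map_cong[OF refl])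
    fix p assume "p \<in> set (rev (sorted_list_of_set A))"
    then have "{x \<in> insert b A. p \<le> x} = {x \<in> A. p \<le> x}" using insert by force
    then show "card {x \<in> insert b A. p \<le> x} = card {x \<in> A. p \<le> x}" by simp
  qed
  moreover have "card {x \<in> insert b A. b \<le> x} = card A + 1"
  proof -
    have "{x \<in> insert b A. b \<le> x} = insert b A" using insert by force
    moreover have "b \<notin> A" using insert by blast
    ultimately show ?thesis using insert by simp
  qed
  moreover have "card (insert b A) = card A + 1" using insert by (subst card_insert_disjoint) auto
  ultimately show ?case using insert by simp
qed simp

lemma map_site_label_S_children:
  assumes "\<sigma> \<in> S_class"
  shows "map site_label (S_children \<sigma>) = sch_production (site_label \<sigma>)"
proof -
  obtain q where "max_at \<sigma> q" using S_class_max_at[OF assms] .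
  then interpret max_at \<sigma> q .
  from assms have av: "avoids_plus \<sigma>" by (simp add: S_class_iff)
  let ?L = "left_sites \<sigma>" let ?R = "right_sites \<sigma>" let ?R' = "right_sites \<sigma> - {q}"
  note q_L = max_in_left_sites[OF av] and q_R = max_in_right_sites
  \<comment> \<open>Since \<open>p \<le> q\<close>, no obstruction appears. The new maximum takes
    the place of the left site \<open>p\<close>, and every old right site is kept.\<close>
  have left: "site_label (ins p \<sigma>) = (card {x \<in> ?L. x \<le> p}, card ?R + 1)" if p: "p \<in> ?L" for p
  proof -
    have pq: "p \<le> q" "\<not> blocked \<sigma> p" using p left_sites_le by (auto simp: left_sites_def)
    have "left_sites (ins p \<sigma>) = {x \<in> ?L. x \<le> p}"
      using pq q_less p by (subst left_sites_ins) auto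
    moreover have "right_sites (ins p \<sigma>) = insert p (Suc ` ?R)"
      using pq q_less right_sites_ge by (subst right_sites_ins) fastforce+
    moreover have "p \<notin> Suc ` ?R" using pq right_sites_ge by fastforce
    ultimately show ?thesis by (simp add: site_label_def card_image)
  qed
  have not_blocked: "\<not> blocked \<sigma> (Suc p)" if "p \<in> ?R" for p
    using not_blocked_max[OF av] blocked_mono right_sites_ge[OF that] by (meson le_SucI)
  have right: "card (right_sites (ins (Suc p) \<sigma>)) = card {x \<in> ?R. p \<le> x}" if p: "p \<in> ?R" for p
  proof -
    have "right_sites (ins (Suc p) \<sigma>) = insert (Suc p) (Suc ` {x \<in> ?R. Suc p \<le> x})"
      using p by (subst right_sites_ins) (auto simp: right_sites_def)
    \<comment> \<open>The new maximum stands where the right site \<open>p\<close> would have moved,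
      so it replaces that site in the count.\<close>
    also have "\<dots> = Suc ` {x \<in> ?R. p \<le> x}" using p by (auto simp: image_iff le_less Suc_le_eq)
    finally show ?thesis by (simp add: card_image)
  qed
  have far: "site_label (ins (Suc p) \<sigma>) = (2, card {x \<in> ?R'. p \<le> x})" if p: "p \<in> ?R'" for p
  proof -
    have qp: "q < p" "p < length \<sigma>" using p right_sites_ge by (auto simp: right_sites_def le_less)
    \<comment> \<open>The obstruction with \<open>c = q\<close> blocks every site before
      \<open>q\<close>, hence the constant 2.\<close>
    have "left_sites (ins (Suc p) \<sigma>) = {q, Suc p}"
      using qp q_L left_sites_le not_blocked p by (subst left_sites_ins) (auto simp: le_less)
    moreover have "{x \<in> ?R. p \<le> x} = {x \<in> ?R'. p \<le> x}" using qp by auto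
    ultimately show ?thesis using right[of p] p qp by (simp add: site_label_def)
  qed
  have next_max: "site_label (ins (Suc q) \<sigma>) = (card ?L + 1, card ?R)"
  proof -
    \<comment> \<open>Old and new maximum are adjacent, which leaves no room for \<open>d\<close>
      between them; all left sites survive.\<close>
    have "left_sites (ins (Suc q) \<sigma>) = insert (Suc q) ?L"
      using q_less q_L left_sites_le not_blocked q_R by (subst left_sites_ins) (auto simp: less_Suc_eq_le)
    moreover have "Suc q \<notin> ?L" using left_sites_le by fastforce
    moreover have "{x \<in> ?R. q \<le> x} = ?R" using right_sites_ge by auto
    ultimately show ?thesis using right[OF q_R] by (simp add: site_label_def)
  qed
  \<comment> \<open>As the smallest right site, \<open>q\<close> comes last after the reversal and
    yields the final label of the production.\<close>
  have R_eq: "sorted_list_of_set ?R = q # sorted_list_of_set ?R'"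
    using q_R right_sites_ge by (intro sorted_distinct_set_unique) auto
  have "map (\<lambda>p. site_label (ins p \<sigma>)) (sorted_list_of_set ?L) =
      map (\<lambda>i. (i, card ?R + 1)) (map (\<lambda>p. card {x \<in> ?L. x \<le> p}) (sorted_list_of_set ?L))"
    using left by simp
  also have "\<dots> = map (\<lambda>i. (i, card ?R + 1)) [1..<card ?L + 1]"
    by (simp only: map_rank_sorted_list_of_set finite_left_sites)
  finally have 1: "map (\<lambda>p. site_label (ins p \<sigma>)) (sorted_list_of_set ?L) = \<dots>" .
  have "map (\<lambda>p. site_label (ins (Suc p) \<sigma>)) (rev (sorted_list_of_set ?R')) =
      map (\<lambda>j. (2, j)) (map (\<lambda>p. card {x \<in> ?R'. p \<le> x}) (rev (sorted_list_of_set ?R')))"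
    using far by simp
  also have "\<dots> = map (\<lambda>j. (2, j)) [1..<card ?R' + 1]"
    by (simp only: map_rank_rev_sorted_list_of_set finite_right_sites finite_Diff)
  also have "card ?R' + 1 = card ?R"
    using q_R by (metis Suc_eq_plus1 card.remove finite_right_sites)
  finally have 2: "map (\<lambda>p. site_label (ins (Suc p) \<sigma>)) (rev (sorted_list_of_set ?R')) =
      map (\<lambda>j. (2, j)) [1..<card ?R]" .
  show ?thesis
    using 1 2 next_max by (simp add: S_children_def R_eq comp_def site_label_def del: upt_Suc)
qed

section \<open>The generating tree\<close>

lemma singleton_mem_S_class: "[1] \<in> S_class"
  by (auto simp: S_class_iff is_perm_def avoids_2_41_3_def avoids_3_14_2_def avoids_plus_def)

lemma site_label_singleton: "site_label [1] = (1, 1)"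
proof -
  have "left_sites [1] = {0}" "right_sites [1] = {0}"
    by (auto simp: left_sites_def right_sites_def blocked_def)
  then show ?thesis by (simp add: site_label_def)
qed

lemma S_class_length_1:
  assumes "\<sigma> \<in> S_class" "length \<sigma> = 1"
  shows "\<sigma> = [1]"
proof -
  from assms(2) obtain x where "\<sigma> = [x]" by (metis One_nat_def length_0_conv length_Suc_conv)
  with assms(1) show ?thesis by (auto simp: S_class_iff is_perm_def)
qed

lemma S_tree_edge_length: "(\<sigma>, \<tau>) \<in> tedges S_tree \<Longrightarrow> length \<tau> = Suc (length \<sigma>)"
  by (auto simp: S_tree_def max_insertion_iff_ins)

text \<open>The value \<open>length \<tau>\<close> is the maximum of \<tau>, and deleting it
  recovers the parent.\<close>

lemma S_tree_parent_unique:
  assumes "(\<sigma>, \<tau>) \<in> tedges S_tree" "(\<sigma>', \<tau>) \<in> tedges S_tree"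
  shows "\<sigma> = \<sigma>'"
proof -
  have "remove1 (length \<tau>) \<tau> = \<sigma>" if "(\<sigma>, \<tau>) \<in> tedges S_tree" for \<sigma>
    using that by (auto simp: S_tree_def max_insertion_iff_ins S_class_iff remove1_ins)
  with assms show ?thesis by metis
qed

lemma S_tree_parent:
  assumes "\<tau> \<in> S_class" "\<tau> \<noteq> [1]"
  obtains \<sigma> where "(\<sigma>, \<tau>) \<in> tedges S_tree"
proof -
  from assms obtain n where n: "length \<tau> = Suc n" "n \<noteq> 0"
    using S_class_length_1 by (cases "length \<tau>") (auto simp: S_class_iff)
  moreover have "is_perm \<tau>" using assms by (simp add: S_class_iff)
  ultimately obtain \<sigma> p where \<sigma>: "is_perm \<sigma>" "length \<sigma> = n" "p \<le> n" "\<tau> = ins p \<sigma>"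
    using is_perm_ex_ins by blast
  then have "\<sigma> \<in> S_class" using ins_mem_S_classD[of \<sigma> p] assms n by auto
  then have "(\<sigma>, \<tau>) \<in> tedges S_tree"
    using \<sigma> assms by (auto simp: S_tree_def max_insertion_iff_ins)
  then show ?thesis by (rule that)
qed

lemma S_tree_depth:
  assumes "\<tau> \<in> S_class"
  shows "has_depth S_tree \<tau> (length \<tau>) \<and> (troot S_tree, \<tau>) \<in> (tedges S_tree)\<^sup>*"
  using assms
proof (induction "length \<tau>" arbitrary: \<tau> rule: less_induct)
  case less
  show ?case
  proof (cases "\<tau> = [1]")
    case True
    then show ?thesis using has_depth.intros(1)[of S_tree] by (simp add: S_tree_def)
  next
    case False
    with less.prems obtain \<sigma> where e: "(\<sigma>, \<tau>) \<in> tedges S_tree" using S_tree_parent by blast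
    then have "\<sigma> \<in> S_class" by (simp add: S_tree_def)
    with less.hyps[of \<sigma>] e show ?thesis
      using has_depth.intros(2)[OF _ e] S_tree_edge_length[OF e] by (auto intro: rtrancl_into_rtrancl)
  qed
qed

lemma is_generating_tree_S_tree: "is_generating_tree S_class length S_tree"
proof -
  have "(\<sigma>, [1]) \<notin> tedges S_tree" for \<sigma>
    using S_tree_edge_length[of \<sigma> "[1]"] by (auto simp: S_tree_def S_class_iff)
  moreover have "\<exists>!\<sigma>. (\<sigma>, \<tau>) \<in> tedges S_tree" if "\<tau> \<in> S_class" "\<tau> \<noteq> [1]" for \<tau>
    using S_tree_parent[OF that] S_tree_parent_unique by metis
  moreover have "tverts S_tree = S_class" "troot S_tree = [1]" "tedges S_tree \<subseteq> S_class \<times> S_class"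
    by (auto simp: S_tree_def)
  ultimately show ?thesis
    unfolding is_generating_tree_def is_rooted_tree_def
    using S_tree_depth singleton_mem_S_class by simp
qed

lemma rtree_iso_S_tree: "rtree_iso S_tree T_Sch"
  unfolding T_Sch_def
proof (rule rtree_iso_rule_tree[where chl = S_children])
  show "is_rooted_tree S_tree"
    using is_generating_tree_S_tree by (simp add: is_generating_tree_def)
  show "site_label (troot S_tree) = (1, 1)"
    using site_label_singleton by (simp add: S_tree_def)
qed (simp_all add: S_tree_def distinct_S_children map_site_label_S_children
  set_S_children[unfolded S_tree_def, simplified] del: sch_production.simps)

section \<open>Enumeration\<close>

definition S_level :: "nat \<Rightarrow> nat list set" where
  "S_level n = {\<sigma> \<in> S_class. length \<sigma> = n}"

lemma finite_S_level: "finite (S_level n)"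
proof (rule finite_subset)
  show "S_level n \<subseteq> permutations_of_set {1..n}"
    unfolding S_level_def S_class_iff is_perm_permutations_of_set by blast
qed simp

lemma S_level_1: "S_level 1 = {[1]}"
proof (intro equalityI subsetI)
  show "\<sigma> \<in> {[1]}" if "\<sigma> \<in> S_level 1" for \<sigma>
    using that S_class_length_1[of \<sigma>] by (simp add: S_level_def)
  show "\<sigma> \<in> S_level 1" if "\<sigma> \<in> {[1]}" for \<sigma>
    using that singleton_mem_S_class by (simp add: S_level_def)
qed

text \<open>The bound on \<open>n\<close> keeps out the root \<open>[1]\<close>, the only vertex
  without a parent.\<close>

lemma S_level_Suc:
  assumes "n \<ge> 1"
  shows "S_level (Suc n) = (\<Union>\<sigma>\<in>S_level n. set (S_children \<sigma>))"
proof (intro equalityI subsetI)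
  fix \<tau> assume \<tau>: "\<tau> \<in> S_level (Suc n)"
  with assms have "\<tau> \<in> S_class" "\<tau> \<noteq> [1]" by (auto simp: S_level_def)
  then obtain \<sigma> where e: "(\<sigma>, \<tau>) \<in> tedges S_tree" using S_tree_parent by blast
  then have "\<sigma> \<in> S_class" by (simp add: S_tree_def)
  with e \<tau> S_tree_edge_length[OF e] show "\<tau> \<in> (\<Union>\<sigma>\<in>S_level n. set (S_children \<sigma>))"
    by (auto simp: S_level_def set_S_children)
next
  fix \<tau> assume "\<tau> \<in> (\<Union>\<sigma>\<in>S_level n. set (S_children \<sigma>))"
  then obtain \<sigma> where "\<sigma> \<in> S_level n" "(\<sigma>, \<tau>) \<in> tedges S_tree"
    by (auto simp: S_level_def set_S_children)
  then show "\<tau> \<in> S_level (Suc n)"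
    using S_tree_edge_length[of \<sigma> \<tau>] by (auto simp: S_level_def S_tree_def)
qed

lemma sum_sch_descendants_S_children:
  assumes "\<sigma> \<in> S_class"
  shows "(\<Sum>\<tau>\<in>set (S_children \<sigma>). sch_descendants j (site_label \<tau>)) =
    sch_descendants (Suc j) (site_label \<sigma>)"
proof -
  have "(\<Sum>\<tau>\<in>set (S_children \<sigma>). sch_descendants j (site_label \<tau>)) =
      sum_list (map (sch_descendants j) (map site_label (S_children \<sigma>)))"
    using distinct_S_children[OF assms] by (simp add: sum_list_distinct_conv_sum_set comp_def)
  then show ?thesis
    by (simp only: map_site_label_S_children[OF assms] sch_descendants.simps)
qed

text \<open>Both sides count the level \<open>n + j + 1\<close>. The induction trades one level of
  actual permutations for one more generation under the rule, hence the arbitrary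
  \<open>j\<close>.\<close>

lemma sum_sch_descendants_S_level:
  "(\<Sum>\<sigma>\<in>S_level (Suc n). sch_descendants j (site_label \<sigma>)) = sch_descendants (n + j) (1, 1)"
proof (induction n arbitrary: j)
  case 0
  then show ?case using S_level_1 site_label_singleton by simp
next
  case (Suc n)
  have "(\<Sum>\<tau>\<in>S_level (Suc (Suc n)). sch_descendants j (site_label \<tau>)) =
      (\<Sum>\<sigma>\<in>S_level (Suc n). \<Sum>\<tau>\<in>set (S_children \<sigma>). sch_descendants j (site_label \<tau>))"
    unfolding S_level_Suc[of "Suc n", simplified]
  proof (rule sum.UNION_disjoint)
    \<comment> \<open>A common child would have two parents.\<close>
    show "\<forall>\<sigma>\<in>S_level (Suc n). \<forall>\<sigma>'\<in>S_level (Suc n). \<sigma> \<noteq> \<sigma>' \<longrightarrow>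
        set (S_children \<sigma>) \<inter> set (S_children \<sigma>') = {}"
      using S_tree_parent_unique by (auto simp: S_level_def set_S_children)
  qed (simp_all add: finite_S_level)
  also have "\<dots> = (\<Sum>\<sigma>\<in>S_level (Suc n). sch_descendants (Suc j) (site_label \<sigma>))"
    by (rule sum.cong[OF refl], rule sum_sch_descendants_S_children) (simp add: S_level_def)
  also have "\<dots> = sch_descendants (n + Suc j) (1, 1)" by (rule Suc)
  finally show ?case by simp
qed

lemma card_S_level:
  assumes "n \<ge> 1"
  shows "card (S_level n) = large_schroeder (n - 1)"
proof -
  obtain m where n: "n = Suc m" using assms by (cases n) auto
  \<comment> \<open>For \<open>j = 0\<close> every summand is 1, so the sum is the
    cardinality.\<close>
  have "card (S_level (Suc m)) = sch_descendants m (1, 1)"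
    using sum_sch_descendants_S_level[where n = m and j = 0] by simp
  then show ?thesis using sch_descendants_root[of m] n by simp
qed

theorem theorem7:
  shows "is_generating_tree S_class length S_tree \<and>
    rtree_iso S_tree T_Sch \<and>
    (\<forall>n\<ge>1. card {\<sigma> \<in> S_class. length \<sigma> = n} = large_schroeder (n - 1)) \<and>
    map large_schroeder [0..<5] = [1, 2, 6, 22, 90] \<and>
    Abs_fps (\<lambda>m. real (large_schroeder m)) =
      (1 - fps_X - fps_sqrt (1 - 6 * fps_X + fps_X ^ 2)) / (2 * fps_X)"
proof (intro conjI)
  show "map large_schroeder [0..<5] = [1, 2, 6, 22, 90]"
    by (simp add: upt_conv_Cons numeral_eq_Suc)
  show "\<forall>n\<ge>1. card {\<sigma> \<in> S_class. length \<sigma> = n} = large_schroeder (n - 1)"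
    using card_S_level by (simp add: S_level_def)
qed (use is_generating_tree_S_tree rtree_iso_S_tree schroeder_fps_closed_form
  in \<open>simp_all add: schroeder_fps_def\<close>)

end
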